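(* For all integers $k,n$ with $1\leq k<n$ and all integers $a_1,\dots,a_k$ with $1\leq a_1<a_2<\cdots<a_k\leq n$, the following identities hold: \[ T(RE_{2k-1,n}(a_1,a_2,\dots,a_k))=T(RE_{2k,n}(a_1,a_2,\dots,a_k))=A^{2}_{2k}(a_1,a_2,\dots,a_k), \] \[ T(RO_{2k,n}(a_1,a_2,\dots,a_k))=T(RO_{2k+1,n}(a_1,a_2,\dots,a_k))=A^{2}_{2k+1}(a_1,a_2,\dots,a_k), \] \[ T(TE_{2k,n}(a_1,a_2,\dots,a_k))=T(TE_{2k+1,n}(a_1,a_2,\dots,a_k))=2^{-k}A^{2}_{2k+1}(a_1,a_2,\dots,a_k), \] \[ T(TO_{2k-1,n}(a_1,a_2,\dots,a_k))=T(TO_{2k,n}(a_1,a_2,\dots,a_k))=2^{-k}A^{2}_{2k}(a_1,a_2,\dots,a_k). \] Here $T(R)$ is the number of domino tilings of a region $R$, the regions $RE$, $RO$, $TE$, $TO$ are the quartered Aztec rectangles, and $A^2_N(a_1,\dots,a_k)$ is the 2-enumeration of antisymmetric monotone triangles of order $N$ whose positive bottom-row entries are $a_1,\dots,a_k$.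
   Context: **Antisymmetric monotone triangles.** A monotone triangle of order $N$ is a triangular array of integers $(a_{i,j})_{1\le j\le i\le N}$, with rows $i=1,\dots,N$ listed from top to bottom and row $i$ being $a_{i,1},\dots,a_{i,i}$, whose entries are strictly increasing along rows ($a_{i,j}<a_{i,j+1}$ for $1\le j<i$) and weakly increasing from left to right along both rising and descending diagonals ($a_{i+1,j}\le a_{i,j}\le a_{i+1,j+1}$ for $1\le j\le i<N$). An antisymmetric monotone triangle (AMT) is a monotone triangle with $a_{i,j}=-a_{i,i+1-j}$ for all $1\le j\le i\le N$. Thus row $i$ of an AMT has exactly $\lfloor i/2\rfloor$ positive entries. For a number $q$, the $q$-weight of an AMT is $q^{w}$, where $w$ is the number of its positive entries (over all rows) that do not appear in the row immediately above the row they are in. For $N\ge 2$ and integers $0<a_1<\dots<a_{\lfloor N/2\rfloor}$, the $q$-enumeration $A^{q}_{N}(a_1,\dots,a_{\lfloor N/2\rfloor})$ is the sum of the $q$-weights of all AMTs of order $N$ whose positive entries in the bottommost row ($i=N$) are exactly $a_1,\dots,a_{\lfloor N/2\rfloor}$. In the claim $q=2$, so the superscript $2$ in $A^2_N$ is the value of $q$, not an exponent. **Domino tilings.** A region is a finite set (union) of unit squares of the square lattice. A domino is the union of two unit squares sharing an edge. A domino tiling of a region $R$ is a covering of $R$ by dominoes contained in $R$ with no gaps or overlaps. $T(R)$ is the number of domino tilings of $R$. **Aztec rectangles.** Identify a unit square $[x,x+1]\times[y,y+1]$, $x,y\in\mathbb{Z}$, with its lower-left corner $(x,y)$. For positive integers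 $m,n$, put \[ B(i,j)=(j-i,\;j+i)\quad(0\le i\le m,\ 1\le j\le n),\qquad W(t,c)=(c-t+1,\;c+t)\quad(1\le t\le m,\ 0\le c\le n). \] The Aztec rectangle $AR_{m,n}$ is the region consisting of all the squares $B(i,j)$ and $W(t,c)$. (The square $W(t,c)$ shares edges exactly with those of $B(t-1,c),B(t-1,c+1),B(t,c),B(t,c+1)$ that exist.) Its sides are: - southwest side: $W(1,0),W(2,0),\dots,W(m,0)$, in order from bottom to top, at positions $1,\dots,m$; - southeast side: $B(0,1),B(0,2),\dots,B(0,n)$, in order from bottom to top, at positions $1,\dots,n$; - northwest side: $B(m,1),\dots,B(m,n)$; - northeast side: $W(1,n),\dots,W(m,n)$. The trimmed Aztec rectangle $TR_{m,n}$ is obtained from $AR_{m,n}$ by removing all squares of its northwest and northeast sides, i.e. all $B(m,j)$, $1\le j\le n$, and all $W(t,n)$, $1\le t\le m$. Positions on its southwest and southeast sides are the same as for $AR_{m,n}$. **Quartered Aztec rectangles.** - $RE_{m,n}(a_1,\dots,a_{\lfloor (m+1)/2\rfloor})$: from $AR_{m,n}$ remove all squares at even positions on the southwest side (all $W(t,0)$ with $t$ even), and remove all squares on the southeast side except those at positions $a_1,\dots,a_{\lfloor (m+1)/2\rfloor}$. - $RO_{m,n}(a_1,\dots,a_{\lfloor m/2\rfloor})$: from $AR_{m,n}$ remove all squares at odd positions on the southwest side, and remove all squares on the southeast side except those at positions $a_1,\dots,a_{\lfloor m/2\rfloor}$. - $TE_{m,n}(a_1,\dots,a_{\lfloor m/2\rfloor})$: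 from $TR_{m,n}$ remove all squares at even positions on the southwest side, and remove the squares on the southeast side at positions $a_1,\dots,a_{\lfloor m/2\rfloor}$ (keeping the other squares of the southeast side). - $TO_{m,n}(a_1,\dots,a_{\lfloor (m+1)/2\rfloor})$: from $TR_{m,n}$ remove all squares at odd positions on the southwest side, and remove the squares on the southeast side at positions $a_1,\dots,a_{\lfloor (m+1)/2\rfloor}$ (keeping the other squares of the southeast side). *)

theory Defs
  imports Complex_Main
begin

text \<open>
  An array is a function on all pairs of naturals of which only the entries \<open>a i j\<close> with
  \<open>1 \<le> j \<le> i \<le> N\<close> matter. The remaining values are fixed to 0, so that distinct functions
  are distinct triangles.
\<close>

definition monotone_triangle :: "nat \<Rightarrow> (nat \<Rightarrow> nat \<Rightarrow> int) \<Rightarrow> bool" where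
  "monotone_triangle N a \<longleftrightarrow>
     (\<forall>i j. \<not> (1 \<le> j \<and> j \<le> i \<and> i \<le> N) \<longrightarrow> a i j = 0) \<and>
     (\<forall>i j. 1 \<le> j \<and> j < i \<and> i \<le> N \<longrightarrow> a i j < a i (j + 1)) \<and>
     (\<forall>i j. 1 \<le> j \<and> j \<le> i \<and> i < N \<longrightarrow> a (i + 1) j \<le> a i j \<and> a i j \<le> a (i + 1) (j + 1))"

definition AMT :: "nat \<Rightarrow> (nat \<Rightarrow> nat \<Rightarrow> int) \<Rightarrow> bool" where
  "AMT N a \<longleftrightarrow> monotone_triangle N a \<and>
     (\<forall>i j. 1 \<le> j \<and> j \<le> i \<and> i \<le> N \<longrightarrow> a i j = - a i (i + 1 - j))"

text \<open>The row above row 1 is empty. The only entry of row 1 of an AMT is 0, so it never counts.\<close>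

definition new_positive_entries :: "nat \<Rightarrow> (nat \<Rightarrow> nat \<Rightarrow> int) \<Rightarrow> nat" where
  "new_positive_entries N a =
     card {(i, j). 1 \<le> j \<and> j \<le> i \<and> i \<le> N \<and> a i j > 0 \<and> a i j \<notin> a (i - 1) ` {1..i - 1}}"

definition q_enumeration :: "real \<Rightarrow> nat \<Rightarrow> (nat \<Rightarrow> int) \<Rightarrow> real" where
  "q_enumeration q N b =
     (\<Sum>a \<in> {a. AMT N a \<and> {x \<in> a N ` {1..N}. x > 0} = b ` {1..N div 2}}.
        q ^ new_positive_entries N a)"

text \<open>\<open>(x, y)\<close> stands for the unit square \<open>[x, x + 1] \<times> [y, y + 1]\<close>.\<close>

type_synonym square = "int \<times> int"

fun share_edge :: "square \<Rightarrow> square \<Rightarrow> bool" where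
  "share_edge (x, y) (x', y') \<longleftrightarrow> \<bar>x - x'\<bar> + \<bar>y - y'\<bar> = 1"

definition domino :: "square set \<Rightarrow> bool" where
  "domino D \<longleftrightarrow> (\<exists>s t. share_edge s t \<and> D = {s, t})"

definition domino_tiling :: "square set \<Rightarrow> square set set \<Rightarrow> bool" where
  "domino_tiling R P \<longleftrightarrow>
     (\<forall>D \<in> P. domino D) \<and> (\<forall>D \<in> P. \<forall>E \<in> P. D \<noteq> E \<longrightarrow> D \<inter> E = {}) \<and> \<Union>P = R"

definition num_tilings :: "square set \<Rightarrow> nat" where
  "num_tilings R = card {P. domino_tiling R P}"

definition sqB :: "int \<Rightarrow> int \<Rightarrow> square" where
  "sqB i j = (j - i, j + i)"

definition sqW :: "int \<Rightarrow> int \<Rightarrow> square" where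
  "sqW t c = (c - t + 1, c + t)"

definition AR :: "nat \<Rightarrow> nat \<Rightarrow> square set" where
  "AR m n = {sqB i j | i j. 0 \<le> i \<and> i \<le> int m \<and> 1 \<le> j \<and> j \<le> int n} \<union>
            {sqW t c | t c. 1 \<le> t \<and> t \<le> int m \<and> 0 \<le> c \<and> c \<le> int n}"

definition TR :: "nat \<Rightarrow> nat \<Rightarrow> square set" where
  "TR m n = AR m n - {sqB (int m) j | j. 1 \<le> j \<and> j \<le> int n}
                   - {sqW t (int n) | t. 1 \<le> t \<and> t \<le> int m}"

text \<open>
  The trimmed rectangle keeps the position numbers of the full one on the southwest side
  \<open>sqW 1 0, sqW 2 0, \<dots>\<close> and on the southeast side \<open>sqB 0 1, sqB 0 2, \<dots>\<close>.
\<close>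

definition SW_squares :: "nat \<Rightarrow> (int \<Rightarrow> bool) \<Rightarrow> square set" where
  "SW_squares m Q = {sqW t 0 | t. 1 \<le> t \<and> t \<le> int m \<and> Q t}"

definition SE_squares :: "nat \<Rightarrow> (int \<Rightarrow> bool) \<Rightarrow> square set" where
  "SE_squares n Q = {sqB 0 j | j. 1 \<le> j \<and> j \<le> int n \<and> Q j}"

definition RE :: "nat \<Rightarrow> nat \<Rightarrow> (nat \<Rightarrow> int) \<Rightarrow> square set" where
  "RE m n a = AR m n - SW_squares m even - SE_squares n (\<lambda>j. j \<notin> a ` {1..(m + 1) div 2})"

definition RO :: "nat \<Rightarrow> nat \<Rightarrow> (nat \<Rightarrow> int) \<Rightarrow> square set" where
  "RO m n a = AR m n - SW_squares m odd - SE_squares n (\<lambda>j. j \<notin> a ` {1..m div 2})"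

definition TE :: "nat \<Rightarrow> nat \<Rightarrow> (nat \<Rightarrow> int) \<Rightarrow> square set" where
  "TE m n a = TR m n - SW_squares m even - SE_squares n (\<lambda>j. j \<in> a ` {1..m div 2})"

definition TO :: "nat \<Rightarrow> nat \<Rightarrow> (nat \<Rightarrow> int) \<Rightarrow> square set" where
  "TO m n a = TR m n - SW_squares m odd - SE_squares n (\<lambda>j. j \<in> a ` {1..(m + 1) div 2})"

end

theory Submission imports Defs begin

text \<open>
  Read a region row by row, along the diagonals that alternately consist of black squares
  \<open>sqB i j\<close> and white squares \<open>sqW t c\<close>. Between two consecutive rows of white squares lies a row of
  black squares, and a tiling is cut there by recording the set \<open>U\<close> of black positions that are
  covered from the far side. Given the sets \<open>A\<close> before and \<open>U\<close> after a row of white squares, the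
  dominoes at this row are perfect matchings of a path in which each position \<open>j\<close> is an edge of
  multiplicity 0, 1 or 2. Such a matching exists iff missing and double positions alternate, starting
  and ending in a way that depends on the two ends of the row, and then each double position can be
  used in two ways (\<open>row_count\<close>). The alternation says precisely that \<open>A\<close> and \<open>U\<close> interlace, and
  the double positions are \<open>A - U\<close> (\<open>num_tilings_full_row\<close>).

  An antisymmetric monotone triangle is a sequence of sets of the same kind: each row is determined
  by its positive entries, two adjacent rows fit together iff their sets of positive entries
  interlace (\<open>interlaced_rows_iff\<close>), and the new positive entries of the lower row are again
  \<open>A - U\<close>. Which of the two sorts of interlacing occurs depends on the parity of the row length, just as
  it depends on the presence of the leftmost white square in the region, where every second one is
  removed. So the two enumerations satisfy the same recursion (\<open>num_tilings_stack\<close>,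
  \<open>weight_sum_Suc\<close>) with the same initial values.

  In a trimmed rectangle the last white square of each row is absent, and one works with the
  complementary sets, which is why there the prescribed squares are removed instead of kept. The
  interlacing condition is unchanged but the roles of missing and double positions are exchanged, so
  that the weight of a row is 2 to the power \<open>card (U - A)\<close>. Since
  \<open>card (A - U) - card (U - A) = card A - card U\<close>, the discrepancy telescopes to the
  factor 2 to the power \<open>k\<close> (\<open>num_tilings_trimmed_stack\<close>).

  Finally, the two regions in each identity differ by one more row of white squares. It corresponds to
  the step from the row of length 1 of a triangle to the empty row, which carries no choice and weight 1.
\<close>

section \<open>Domino tilings of finite regions\<close>

lemma share_edge_sym: "share_edge s t \<longleftrightarrow> share_edge t s"
  by (cases s; cases t) (simp add: abs_minus_commute)

lemma domino_tilingD:
  assumes "domino_tiling R P"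
  shows "\<Union>P = R" "D \<in> P \<Longrightarrow> domino D" "D \<in> P \<Longrightarrow> D \<subseteq> R"
    "D \<in> P \<Longrightarrow> E \<in> P \<Longrightarrow> x \<in> D \<Longrightarrow> x \<in> E \<Longrightarrow> D = E"
proof -
  show U: "\<Union>P = R" and "D \<in> P \<Longrightarrow> domino D"
    using assms by (simp_all add: domino_tiling_def)
  show "D \<in> P \<Longrightarrow> D \<subseteq> R" using U by blast
  show "D \<in> P \<Longrightarrow> E \<in> P \<Longrightarrow> x \<in> D \<Longrightarrow> x \<in> E \<Longrightarrow> D = E"
    using assms unfolding domino_tiling_def by (metis IntI empty_iff)
qed

lemma domino_tilingI:
  assumes "\<And>D. D \<in> P \<Longrightarrow> domino D"
    and "\<And>D E x. D \<in> P \<Longrightarrow> E \<in> P \<Longrightarrow> x \<in> D \<Longrightarrow> x \<in> E \<Longrightarrow> D = E"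
    and "\<Union>P = R"
  shows "domino_tiling R P"
  unfolding domino_tiling_def using assms by (metis disjoint_iff)

lemma dominoE:
  assumes "domino D" "w \<in> D"
  obtains b where "share_edge w b" "D = {w, b}"
  using assms share_edge_sym unfolding domino_def by (metis insertE insert_commute singletonD)

lemma dominoI: "share_edge s t \<Longrightarrow> domino {s, t}"
  unfolding domino_def by blast

lemma domino_nonempty: "domino D \<Longrightarrow> D \<noteq> {}"
  unfolding domino_def by blast

lemma finite_tilings:
  assumes "finite R"
  shows "finite {P. domino_tiling R P}"
  by (rule finite_subset[of _ "Pow (Pow R)"]) (use assms in \<open>auto dest: domino_tilingD(3)\<close>)

lemma num_tilings_empty [simp]: "num_tilings {} = 1"
proof -
  have "P = {}" if "domino_tiling {} P" for P
    using domino_tilingD(2,3)[OF that] domino_nonempty by blast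
  moreover have "domino_tiling {} {}" by (rule domino_tilingI) auto
  ultimately have "{P. domino_tiling {} P} = {{}}" by blast
  then show ?thesis by (simp add: num_tilings_def)
qed

lemma domino_tiling_Un:
  assumes P: "domino_tiling R P" and P': "domino_tiling R' P'" and dis: "R \<inter> R' = {}"
  shows "domino_tiling (R \<union> R') (P \<union> P')"
proof (rule domino_tilingI)
  show "domino D" if "D \<in> P \<union> P'" for D
    using that domino_tilingD(2)[OF P] domino_tilingD(2)[OF P'] by blast
  show "\<Union>(P \<union> P') = R \<union> R'"
    using domino_tilingD(1)[OF P] domino_tilingD(1)[OF P'] by simp
  have "x \<notin> E" if "D \<in> P" "E \<in> P'" "x \<in> D" for D E x
    using that dis domino_tilingD(3)[OF P] domino_tilingD(3)[OF P'] by blast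
  then show "D = E" if "D \<in> P \<union> P'" "E \<in> P \<union> P'" "x \<in> D" "x \<in> E" for D E x
    using that domino_tilingD(4)[OF P, of D E x] domino_tilingD(4)[OF P', of D E x] by blast
qed

lemma domino_tiling_restrict:
  assumes P: "domino_tiling R P" and "Q \<subseteq> P"
  shows "domino_tiling (\<Union>Q) Q" "\<Union>(P - Q) = R - \<Union>Q"
proof -
  show "domino_tiling (\<Union>Q) Q"
    using domino_tilingD(2,4)[OF P] assms(2) by (intro domino_tilingI) blast+
  have "x \<notin> \<Union>Q" if "x \<in> D" "D \<in> P - Q" for x D
    using domino_tilingD(4)[OF P, of D _ x] assms(2) that by blast
  then show "\<Union>(P - Q) = R - \<Union>Q"
    using assms(2) by (subst domino_tilingD(1)[OF P, symmetric]) blast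
qed

text \<open>
  Classify the tilings by the partner \<open>b\<close> of the square \<open>w\<close>. The two corollaries are the
  cases of no candidate and of one candidate; with them a row of squares can be tiled from its end.
\<close>

lemma num_tilings_expand:
  assumes fin: "finite R" and w: "w \<in> R"
  shows "num_tilings R = (\<Sum>b \<in> {b \<in> R. share_edge w b}. num_tilings (R - {w, b}))"
proof -
  let ?N = "{b \<in> R. share_edge w b}"
  let ?tl = "\<lambda>b. {P. domino_tiling (R - {w, b}) P}"
  have ins: "domino_tiling R (insert {w, b} P)"
    if "b \<in> ?N" "domino_tiling (R - {w, b}) P" for b P
  proof -
    have "domino_tiling {w, b} {{w, b}}"
      using that(1) by (intro domino_tilingI) (simp_all add: dominoI)
    from domino_tiling_Un[OF this that(2)]
    have "domino_tiling ({w, b} \<union> (R - {w, b})) (insert {w, b} P)" by simp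
    moreover have "{w, b} \<union> (R - {w, b}) = R" using that(1) w by blast
    ultimately show ?thesis by simp
  qed
  have del: "\<exists>b\<in>?N. P \<in> insert {w, b} ` ?tl b" if P: "domino_tiling R P" for P
  proof -
    have "w \<in> \<Union>P" using w domino_tilingD(1)[OF P] by simp
    then obtain D where D: "D \<in> P" "w \<in> D" by blast
    obtain b where b: "share_edge w b" "D = {w, b}"
      using dominoE[OF domino_tilingD(2)[OF P D(1)] D(2)] .
    have "b \<in> ?N" using domino_tilingD(3)[OF P D(1)] b by blast
    moreover have "domino_tiling (R - {w, b}) (P - {D})"
      using domino_tiling_restrict(2)[OF P, of "{D}"]
        domino_tiling_restrict(1)[OF P, of "P - {D}"] D(1) b(2) by simp
    moreover have "P = insert {w, b} (P - {D})" using D(1) b(2) by blast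
    ultimately show ?thesis by blast
  qed
  have eq: "{P. domino_tiling R P} = (\<Union>b\<in>?N. insert {w, b} ` ?tl b)"
  proof (intro equalityI subsetI)
    fix P assume "P \<in> {P. domino_tiling R P}"
    then show "P \<in> (\<Union>b\<in>?N. insert {w, b} ` ?tl b)" using del[of P] by simp
  next
    fix P assume "P \<in> (\<Union>b\<in>?N. insert {w, b} ` ?tl b)"
    then obtain b P' where b: "b \<in> ?N" "domino_tiling (R - {w, b}) P'" "P = insert {w, b} P'"
      by blast
    then show "P \<in> {P. domino_tiling R P}" using ins[OF b(1,2)] by simp
  qed
  have "num_tilings R = (\<Sum>b\<in>?N. card (insert {w, b} ` ?tl b))"
    unfolding num_tilings_def eq
  proof (rule card_UN_disjoint)
    show "\<forall>b\<in>?N. finite (insert {w, b} ` ?tl b)"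
      using fin by (intro ballI finite_imageI finite_tilings) simp
    show "\<forall>b\<in>?N. \<forall>b'\<in>?N. b \<noteq> b' \<longrightarrow> insert {w, b} ` ?tl b \<inter> insert {w, b'} ` ?tl b' = {}"
    proof (intro ballI impI equals0I)
      fix b b' P assume b: "b \<in> ?N" "b' \<in> ?N" "b \<noteq> b'"
        and P: "P \<in> insert {w, b} ` ?tl b \<inter> insert {w, b'} ` ?tl b'"
      obtain P1 where P1: "P1 \<in> ?tl b" "P = insert {w, b} P1" using IntD1[OF P] by (rule imageE)
      obtain P2 where P2: "P = insert {w, b'} P2" using IntD2[OF P] by (rule imageE)
      have "domino_tiling R P"
        unfolding P1(2) by (rule ins[OF b(1)]) (rule CollectD[OF P1(1)])
      moreover have "{w, b} \<in> P" unfolding P1(2) by (rule insertI1)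
      moreover have "{w, b'} \<in> P" unfolding P2 by (rule insertI1)
      ultimately have "{w, b} = {w, b'}" by (rule domino_tilingD(4)[where x = w]) simp_all
      then show False using b(3) by (simp add: doubleton_eq_iff)
    qed
  qed (use fin in simp)
  also have "\<dots> = (\<Sum>b\<in>?N. num_tilings (R - {w, b}))"
  proof (rule sum.cong[OF refl])
    fix b assume "b \<in> ?N"
    have "inj_on (insert {w, b}) (?tl b)"
    proof (rule inj_onI)
      fix P Q assume PQ: "P \<in> ?tl b" "Q \<in> ?tl b" "insert {w, b} P = insert {w, b} Q"
      then have "{w, b} \<notin> P" "{w, b} \<notin> Q" using domino_tilingD(3) by blast+
      then show "P = Q" using PQ(3) by (metis insert_ident)
    qed
    then show "card (insert {w, b} ` ?tl b) = num_tilings (R - {w, b})"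
      by (simp add: card_image num_tilings_def)
  qed
  finally show ?thesis .
qed

corollary num_tilings_isolated:
  assumes "finite R" "w \<in> R" "\<And>b. b \<in> R \<Longrightarrow> \<not> share_edge w b"
  shows "num_tilings R = 0"
proof -
  have N: "{b \<in> R. share_edge w b} = {}" using assms(3) by blast
  show ?thesis unfolding num_tilings_expand[OF assms(1,2)] N by simp
qed

corollary num_tilings_forced:
  assumes "finite R" "w \<in> R" "v \<in> R" "share_edge w v"
    and "\<And>b. b \<in> R \<Longrightarrow> share_edge w b \<Longrightarrow> b = v"
  shows "num_tilings R = num_tilings (R - {w, v})"
proof -
  have N: "{b \<in> R. share_edge w b} = {v}" using assms(3-5) by blast
  show ?thesis unfolding num_tilings_expand[OF assms(1,2)] N by simp
qed

text \<open>
  A transfer-matrix step. Because no domino joins \<open>L\<close> to \<open>U\<close>, a tiling splits into the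
  dominoes that meet \<open>L\<close> and the others, and the only freedom is the set \<open>T\<close> of squares of
  the interface \<open>M\<close> that are used by the first kind. The condition that no domino lies inside
  \<open>M\<close> is what makes the splitting invertible: every domino of a tiling of \<open>L \<union> T\<close> meets \<open>L\<close>.
\<close>

lemma num_tilings_separator:
  assumes fin: "finite L" "finite M" "finite U"
    and dis: "L \<inter> M = {}" "L \<inter> U = {}" "M \<inter> U = {}"
    and LU: "\<And>s t. s \<in> L \<Longrightarrow> t \<in> U \<Longrightarrow> \<not> share_edge s t"
    and MM: "\<And>s t. s \<in> M \<Longrightarrow> t \<in> M \<Longrightarrow> \<not> share_edge s t"
  shows "num_tilings (L \<union> M \<union> U) =
    (\<Sum>T \<in> Pow M. num_tilings (L \<union> T) * num_tilings ((M - T) \<union> U))"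
proof -
  let ?R = "L \<union> M \<union> U"
  let ?X = "SIGMA T:Pow M. {P. domino_tiling (L \<union> T) P} \<times> {Q. domino_tiling ((M - T) \<union> U) Q}"
  let ?lower = "\<lambda>P. {D \<in> P. D \<inter> L \<noteq> {}}"
  let ?f = "\<lambda>(T, P, Q). P \<union> Q"
  let ?g = "\<lambda>P. (\<Union>(?lower P) \<inter> M, ?lower P, P - ?lower P)"
  have meets: "D \<inter> L \<noteq> {}" if D: "domino D" "D \<subseteq> L \<union> M" for D
  proof
    assume L: "D \<inter> L = {}"
    obtain w where w: "w \<in> D" using domino_nonempty[OF D(1)] by blast
    obtain b where "share_edge w b" "D = {w, b}" using dominoE[OF D(1) w] .
    then show False using MM[of w b] D(2) L by blast
  qed
  have avoids: "D \<inter> U = {}" if D: "domino D" "D \<inter> L \<noteq> {}" for D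
  proof -
    obtain w where w: "w \<in> D" "w \<in> L" using D(2) by blast
    obtain b where "share_edge w b" "D = {w, b}" using dominoE[OF D(1) w(1)] .
    then show ?thesis using LU[of w b] w(2) dis(2) by blast
  qed
  have gf: "?g (?f x) = x" if "x \<in> ?X" for x
  proof -
    obtain T P Q where x: "x = (T, P, Q)" by (cases x)
    with that have T: "T \<subseteq> M" and P: "domino_tiling (L \<union> T) P"
      and Q: "domino_tiling ((M - T) \<union> U) Q" by simp_all
    have "D \<inter> L \<noteq> {}" if "D \<in> P" for D
      using meets[OF domino_tilingD(2)[OF P that]] domino_tilingD(3)[OF P that] T by blast
    moreover have "D \<inter> L = {}" if "D \<in> Q" for D
      using domino_tilingD(3)[OF Q that] dis by blast
    ultimately have low: "?lower (P \<union> Q) = P" and "P \<union> Q - P = Q" by blast+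
    moreover have "\<Union>P \<inter> M = T" using domino_tilingD(1)[OF P] T dis by blast
    ultimately show ?thesis by (simp only: x low prod.case)
  qed
  have gX: "?g P \<in> ?X" if P: "domino_tiling ?R P" for P
  proof -
    define P\<^sub>L where "P\<^sub>L = ?lower P"
    define V where "V = \<Union>P\<^sub>L"
    have sub: "P\<^sub>L \<subseteq> P" by (simp add: P\<^sub>L_def)
    have "D \<subseteq> L \<union> M" if "D \<in> P\<^sub>L" for D
    proof -
      have D: "D \<in> P" "D \<inter> L \<noteq> {}" using that by (simp_all add: P\<^sub>L_def)
      show ?thesis
        using domino_tilingD(3)[OF P D(1)] avoids[OF domino_tilingD(2)[OF P D(1)] D(2)] by blast
    qed
    then have "V \<subseteq> L \<union> M" unfolding V_def by (rule Union_least)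
    moreover have "L \<subseteq> V"
    proof
      fix x assume x: "x \<in> L"
      then have "x \<in> \<Union>P" using domino_tilingD(1)[OF P] by simp
      then obtain D where D: "D \<in> P" "x \<in> D" by (rule UnionE)
      then have "D \<in> P\<^sub>L" using x unfolding P\<^sub>L_def by blast
      then show "x \<in> V" unfolding V_def using D(2) by (rule UnionI)
    qed
    ultimately have V: "V = L \<union> (V \<inter> M)" and rest: "?R - V = (M - V \<inter> M) \<union> U"
      using dis by blast+
    have "domino_tiling (L \<union> (V \<inter> M)) P\<^sub>L"
      using domino_tiling_restrict(1)[OF P sub] V by (simp add: V_def)
    moreover have "domino_tiling ((M - V \<inter> M) \<union> U) (P - P\<^sub>L)"
      using domino_tiling_restrict(1)[OF P, of "P - P\<^sub>L"] domino_tiling_restrict(2)[OF P sub] rest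
      by (simp add: V_def)
    ultimately have "(V \<inter> M, P\<^sub>L, P - P\<^sub>L) \<in> ?X" by simp
    then show ?thesis by (simp only: V_def P\<^sub>L_def)
  qed
  have fX: "domino_tiling ?R (?f x)" if "x \<in> ?X" for x
  proof -
    obtain T P Q where x: "x = (T, P, Q)" by (cases x)
    with that have T: "T \<subseteq> M" and P: "domino_tiling (L \<union> T) P"
      and Q: "domino_tiling ((M - T) \<union> U) Q" by simp_all
    have "domino_tiling ((L \<union> T) \<union> ((M - T) \<union> U)) (P \<union> Q)"
      by (rule domino_tiling_Un[OF P Q]) (use T dis in blast)
    moreover have "(L \<union> T) \<union> ((M - T) \<union> U) = ?R" using T by blast
    ultimately show ?thesis by (simp add: x)
  qed
  have "bij_betw ?f ?X {P. domino_tiling ?R P}"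
    by (rule bij_betw_byWitness[where f' = ?g]) (use gf gX fX in \<open>simp_all only: image_subset_iff mem_Collect_eq Ball_def, blast+\<close>)
  then have "num_tilings ?R = card ?X"
    by (simp add: num_tilings_def bij_betw_same_card)
  also have "\<dots> = (\<Sum>T \<in> Pow M. card ({P. domino_tiling (L \<union> T) P} \<times> {Q. domino_tiling ((M - T) \<union> U) Q}))"
    using fin by (intro card_SigmaI) (auto intro!: finite_tilings finite_cartesian_product intro: finite_subset)
  finally show ?thesis by (simp add: num_tilings_def card_cartesian_product)
qed

section \<open>A single row of white squares\<close>

lemma sqB_eq_iff [simp]: "sqB i j = sqB i' j' \<longleftrightarrow> i = i' \<and> j = j'"
  by (auto simp: sqB_def)

lemma sqW_eq_iff [simp]: "sqW i j = sqW i' j' \<longleftrightarrow> i = i' \<and> j = j'"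
  by (auto simp: sqW_def)

lemma sqB_neq_sqW [simp]: "sqB i j \<noteq> sqW t c" "sqW t c \<noteq> sqB i j"
  unfolding sqB_def sqW_def prod.inject by presburger+

lemma share_edge_simps [simp]:
  "\<not> share_edge (sqB i j) (sqB i' j')"
  "\<not> share_edge (sqW t c) (sqW t' c')"
  "share_edge (sqW t c) (sqB i j) \<longleftrightarrow> (i = t - 1 \<or> i = t) \<and> (j = c \<or> j = c + 1)"
  "share_edge (sqB i j) (sqW t c) \<longleftrightarrow> (i = t - 1 \<or> i = t) \<and> (j = c \<or> j = c + 1)"
  unfolding sqB_def sqW_def share_edge.simps by presburger+

text \<open>
  White squares \<open>0, \<dots>, g\<close> of row \<open>t\<close>, with the black squares \<open>S\<close> below and \<open>T\<close> above them,
  cut off after position \<open>h\<close>. Both black squares at position \<open>j\<close> have the same two white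
  neighbours \<open>j - 1\<close> and \<open>j\<close>; so \<open>S\<close> and \<open>T\<close> describe a path on the white squares whose edges
  have multiplicity 0, 1 or 2, and a tiling directs each edge to an endpoint so that each white
  square is hit once.
\<close>

definition row :: "int \<Rightarrow> int set \<Rightarrow> int set \<Rightarrow> int \<Rightarrow> int \<Rightarrow> square set" where
  "row t S T g h = sqW t ` {0..g} \<union> sqB (t - 1) ` (S \<inter> {0..h}) \<union> sqB t ` (T \<inter> {0..h})"

text \<open>
  Edges minus vertices of the path up to the white squares \<open>0, \<dots>, h - 1\<close>. In a region that can be
  tiled this is 0 or 1, according to whether these black squares leave the white square \<open>h\<close> free or
  use it.
\<close>

definition excess :: "int set \<Rightarrow> int set \<Rightarrow> nat \<Rightarrow> int" where
  "excess S T h = int (card (S \<inter> {0..int h})) + int (card (T \<inter> {0..int h})) - int h"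

lemma Int_atLeastAtMost_step:
  "S \<inter> {0..1 + int h} =
     (if 1 + int h \<in> S then insert (1 + int h) (S \<inter> {0..int h}) else S \<inter> {0..int h})"
  by (auto simp: le_less)

lemma card_Int_atLeastAtMost_step:
  "card (S \<inter> {0..1 + int h}) = card (S \<inter> {0..int h}) + of_bool (1 + int h \<in> S)"
  unfolding Int_atLeastAtMost_step by simp

lemma finite_row [simp]: "finite (row t S T g h)"
  by (simp add: row_def)

text \<open>
  The two counts refer to the same black squares, with and without the last white square \<open>h\<close>, and
  are proved together by running along the row. Without that square the black squares at position
  \<open>h\<close> can only be paired to the left; with it, the square \<open>h\<close> has to be paired with one of them.
  This gives an automaton with the two states excess 1 and excess 0: a missing position leads from 1
  to 0, a single one keeps the state, and a double one leads from 0 to 1 with two possible tilings.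
  No other step is possible, and each double position contributes a factor 2.
\<close>

lemma row_count:
  assumes "0 \<notin> S"
  shows "num_tilings (row t S T (int h) (int h)) =
       (if (\<forall>i\<le>h. excess S T i \<in> {0, 1}) \<and> excess S T h = 1
        then 2 ^ card (S \<inter> T \<inter> {0..int h}) else 0)"
    and "num_tilings (row t S T (int h - 1) (int h)) =
       (if (\<forall>i\<le>h. excess S T i \<in> {0, 1}) \<and> excess S T h = 0
        then 2 ^ card (S \<inter> T \<inter> {0..int h}) else 0)"
proof (induction h)
  case 0
  have ex: "excess S T 0 = of_bool (0 \<in> T)" by (simp add: excess_def assms)
  {
    case 1
    have r: "row t S T 0 0 = (if 0 \<in> T then {sqW t 0, sqB t 0} else {sqW t 0})"
      by (auto simp: row_def assms)
    have "num_tilings {sqW t 0} = 0"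
      by (rule num_tilings_isolated[of _ "sqW t 0"]) auto
    moreover have "num_tilings {sqW t 0, sqB t 0} =
        num_tilings ({sqW t 0, sqB t 0} - {sqW t 0, sqB t 0})"
      by (rule num_tilings_forced) auto
    ultimately show ?case by (simp add: r ex assms)
  next
    case 2
    have r: "row t S T (-1) 0 = (if 0 \<in> T then {sqB t 0} else {})"
      by (auto simp: row_def assms)
    have "num_tilings {sqB t 0} = 0"
      by (rule num_tilings_isolated[of _ "sqB t 0"]) auto
    then show ?case by (simp add: r ex assms)
  }
next
  case (Suc h)
  let ?j = "1 + int h" and ?b = "sqB (t - 1) (1 + int h)" and ?b' = "sqB t (1 + int h)"
  let ?H = "row t S T (int h) (int h)" and ?G = "row t S T (int h - 1) (int h)"
  have ex: "excess S T (Suc h) = excess S T h + of_bool (?j \<in> S) + of_bool (?j \<in> T) - 1"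
    unfolding excess_def by (simp add: card_Int_atLeastAtMost_step)
  have d: "card (S \<inter> T \<inter> {0..int (Suc h)}) =
      card (S \<inter> T \<inter> {0..int h}) + of_bool (?j \<in> S \<and> ?j \<in> T)"
    using card_Int_atLeastAtMost_step[of "S \<inter> T" h] by simp
  have all: "(\<forall>i\<le>Suc h. excess S T i \<in> {0, 1}) \<longleftrightarrow>
      (\<forall>i\<le>h. excess S T i \<in> {0, 1}) \<and> excess S T (Suc h) \<in> {0, 1}"
    by (auto simp: le_Suc_eq)
  note r = row_def[of t S T] Int_atLeastAtMost_step
  {
    case 1
    let ?R = "row t S T (int (Suc h)) (int (Suc h))" and ?w = "sqW t (1 + int h)"
    have w: "?w \<in> ?R" by (auto simp: row_def)
    consider "?j \<notin> S" "?j \<notin> T" | "?j \<in> S" "?j \<notin> T" | "?j \<notin> S" "?j \<in> T" | "?j \<in> S" "?j \<in> T"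
      by blast
    then have "num_tilings ?R = (if ?j \<in> S then if ?j \<in> T then 2 * num_tilings ?G else num_tilings ?H
       else if ?j \<in> T then num_tilings ?H else 0)"
    proof cases
      case 1
      have "num_tilings ?R = 0"
        by (rule num_tilings_isolated[OF finite_row w]) (use 1 in \<open>auto simp: r\<close>)
      then show ?thesis using 1 by simp
    next
      case 2
      have "num_tilings ?R = num_tilings (?R - {?w, ?b})"
        by (rule num_tilings_forced[OF finite_row w]) (use 2 in \<open>auto simp: r\<close>)
      also have "?R - {?w, ?b} = ?H" using 2 by (auto simp: r)
      finally show ?thesis using 2 by simp
    next
      case 3
      have "num_tilings ?R = num_tilings (?R - {?w, ?b'})"
        by (rule num_tilings_forced[OF finite_row w]) (use 3 in \<open>auto simp: r\<close>)
      also have "?R - {?w, ?b'} = ?H" using 3 by (auto simp: r)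
      finally show ?thesis using 3 by simp
    next
      case 4
      then have N: "{b \<in> ?R. share_edge ?w b} = {?b, ?b'}" by (auto simp: r)
      have exp: "num_tilings ?R = num_tilings (?R - {?w, ?b}) + num_tilings (?R - {?w, ?b'})"
        unfolding num_tilings_expand[OF finite_row w] N by simp
      have "num_tilings (?R - {?w, ?b}) = num_tilings (?R - {?w, ?b} - {?b', sqW t (int h)})"
        by (rule num_tilings_forced) (use 4 in \<open>auto simp: r\<close>)
      also have "?R - {?w, ?b} - {?b', sqW t (int h)} = ?G" using 4 by (auto simp: r)
      finally have 5: "num_tilings (?R - {?w, ?b}) = num_tilings ?G" .
      have "num_tilings (?R - {?w, ?b'}) = num_tilings (?R - {?w, ?b'} - {?b, sqW t (int h)})"
        by (rule num_tilings_forced) (use 4 in \<open>auto simp: r\<close>)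
      also have "?R - {?w, ?b'} - {?b, sqW t (int h)} = ?G" using 4 by (auto simp: r)
      finally show ?thesis using exp 4 5 by simp
    qed
    then show ?case using Suc.IH unfolding ex d all by auto
  next
    case 2
    let ?R = "row t S T (int (Suc h) - 1) (int (Suc h))" and ?w = "sqW t (int h)"
    have w: "?w \<in> ?R" by (auto simp: row_def)
    consider "?j \<notin> S" "?j \<notin> T" | "?j \<in> S" "?j \<notin> T" | "?j \<notin> S" "?j \<in> T" | "?j \<in> S" "?j \<in> T"
      by blast
    then have "num_tilings ?R = (if ?j \<in> S then if ?j \<in> T then 0 else num_tilings ?G
       else if ?j \<in> T then num_tilings ?G else num_tilings ?H)"
    proof cases
      case 1
      then have "?R = ?H" by (auto simp: r)
      then show ?thesis using 1 by simp
    next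
      case 2
      have "num_tilings ?R = num_tilings (?R - {?b, ?w})"
        by (rule num_tilings_forced) (use 2 in \<open>auto simp: r\<close>)
      also have "?R - {?b, ?w} = ?G" using 2 by (auto simp: r)
      finally show ?thesis using 2 by simp
    next
      case 3
      have "num_tilings ?R = num_tilings (?R - {?b', ?w})"
        by (rule num_tilings_forced) (use 3 in \<open>auto simp: r\<close>)
      also have "?R - {?b', ?w} = ?G" using 3 by (auto simp: r)
      finally show ?thesis using 3 by simp
    next
      case 4
      have "num_tilings ?R = num_tilings (?R - {?b, ?w})"
        by (rule num_tilings_forced) (use 4 in \<open>auto simp: r\<close>)
      also have "\<dots> = 0"
        by (rule num_tilings_isolated[of _ ?b']) (use 4 in \<open>auto simp: r\<close>)
      finally show ?thesis using 4 by simp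
    qed
    then show ?case using Suc.IH unfolding ex d all by auto
  }
qed

section \<open>Interlacing sets\<close>

text \<open>
  The elements of \<open>A\<close> and \<open>U\<close> alternate weakly. Stated through the number of elements of \<open>A\<close>
  and of \<open>U\<close> up to \<open>i\<close>, the condition is at once the two-state automaton of \<open>row_count\<close> and the
  comparison of two adjacent rows of a triangle. For \<open>c = 0\<close> the alternation is
  \<open>a\<^sub>1 \<le> u\<^sub>1 \<le> a\<^sub>2 \<le> \<dots> \<le> a\<^sub>p\<close>, and for \<open>c = 1\<close> it is \<open>u\<^sub>1 \<le> a\<^sub>1 \<le> \<dots> \<le> u\<^sub>p \<le> a\<^sub>p\<close>.
\<close>

definition interlaced :: "int \<Rightarrow> int set \<Rightarrow> int set \<Rightarrow> bool" where
  "interlaced c A U \<longleftrightarrow>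
     (\<forall>i::nat. c + int (card (A \<inter> {1..int i})) - int (card (U \<inter> {1..int i})) \<in> {0, 1}) \<and>
     c + int (card A) = int (card U) + 1"

text \<open>
  In both alternations the largest element of \<open>A\<close> dominates \<open>U\<close>, so that all the sums over the
  next row can be taken over the subsets of one fixed interval.
\<close>

lemma interlaced_bounded:
  assumes "interlaced c A U" "A \<subseteq> {1..int n}" "finite U" "U \<subseteq> {1..}"
  shows "U \<subseteq> {1..int n}"
proof -
  have "A \<inter> {1..int n} = A" using assms by auto
  moreover have "c + int (card (A \<inter> {1..int n})) - int (card (U \<inter> {1..int n})) \<in> {0, 1}"
    "c + int (card A) = int (card U) + 1"
    using assms(1) unfolding interlaced_def by blast+
  ultimately have "card (U \<inter> {1..int n}) \<ge> card U" by auto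
  then have "U \<inter> {1..int n} = U" using assms(3) by (intro card_seteq) auto
  then show ?thesis by auto
qed

lemma interlaced_truncate:
  assumes "A \<subseteq> {1..int n}" "U \<subseteq> {1..int n}"
  shows "interlaced c A U \<longleftrightarrow>
    (\<forall>i\<le>n. c + int (card (A \<inter> {1..int i})) - int (card (U \<inter> {1..int i})) \<in> {0, 1}) \<and>
    c + int (card (A \<inter> {1..int n})) - int (card (U \<inter> {1..int n})) = 1"
proof -
  have stable: "A \<inter> {1..int i} = A" "U \<inter> {1..int i} = U" if "n \<le> i" for i
    using assms that by fastforce+
  have "c + int (card (A \<inter> {1..int i})) - int (card (U \<inter> {1..int i})) \<in> {0, 1}"
    if "c + int (card (A \<inter> {1..int n})) - int (card (U \<inter> {1..int n})) = 1" "n \<le> i" for i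
    using that stable[of n] stable[of i] by simp
  then show ?thesis unfolding interlaced_def using stable[of n]
    by (smt (verit) nle_le order_refl)
qed

lemma card_complement_prefix:
  assumes "i \<le> n"
  shows "int (card (({1..int n} - U) \<inter> {1..int i})) = int i - int (card (U \<inter> {1..int i}))"
proof -
  have "({1..int n} - U) \<inter> {1..int i} = {1..int i} - (U \<inter> {1..int i})" using assms by auto
  then have "card (({1..int n} - U) \<inter> {1..int i}) = i - card (U \<inter> {1..int i})"
    by (simp add: card_Diff_subset)
  moreover have "card (U \<inter> {1..int i}) \<le> i"
    using card_mono[of "{1..int i}" "U \<inter> {1..int i}"] by simp
  ultimately show ?thesis by simp
qed

text \<open>
  The parameter \<open>c\<close> tells whether the leftmost white square is missing. A missing square is
  simulated by putting it back together with one extra black square at position 0, whose only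
  neighbour it is; so removing the square amounts to an initial excess of 1.
\<close>

lemma num_tilings_row:
  assumes c: "c \<in> {0, 1}" and ST: "S \<subseteq> {1..int n}" "T \<subseteq> {1..int n}"
  defines "D \<equiv> \<lambda>i. c + int (card (S \<inter> {1..int i})) + int (card (T \<inter> {1..int i})) - int i"
  shows "num_tilings (sqW t ` {c..int n} \<union> sqB (t - 1) ` S \<union> sqB t ` T) =
      (if (\<forall>i\<le>n. D i \<in> {0, 1}) \<and> D n = 1 then 2 ^ card (S \<inter> T) else 0)"
    and "n \<ge> 1 \<Longrightarrow> num_tilings (sqW t ` {c..int n - 1} \<union> sqB (t - 1) ` S \<union> sqB t ` T) =
      (if (\<forall>i\<le>n. D i \<in> {0, 1}) \<and> D n = 0 then 2 ^ card (S \<inter> T) else 0)"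
proof -
  define T' where "T' = (if c = 0 then T else insert 0 T)"
  have fin: "finite S" "finite T" using ST by (auto intro: finite_subset)
  have S0: "0 \<notin> S" "0 \<notin> T" using ST by auto
  have S: "S \<inter> {0..int i} = S \<inter> {1..int i}" for i using ST by auto
  have T: "T' \<inter> {0..int i} = (if c = 0 then T \<inter> {1..int i} else insert 0 (T \<inter> {1..int i}))" for i
    using ST by (auto simp: T'_def)
  have D: "excess S T' i = D i" for i
    using c S0 unfolding excess_def D_def S T by auto
  have d: "S \<inter> T' \<inter> {0..int n} = S \<inter> T" using ST by (auto simp: T'_def)
  have whites: "num_tilings (row t S T' g (int n)) =
      num_tilings (sqW t ` {c..g} \<union> sqB (t - 1) ` S \<union> sqB t ` T)" if "0 \<le> g" for g
  proof (cases "c = 0")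
    case True
    have "S \<inter> {0..int n} = S" "T \<inter> {0..int n} = T" using ST by auto
    then show ?thesis using True by (simp add: row_def T'_def)
  next
    case False
    then have c1: "c = 1" using c by simp
    have "S \<inter> {0..int n} = S" "T' \<inter> {0..int n} = insert 0 T" using ST c1 by (auto simp: T'_def)
    then have r: "row t S T' g (int n) = sqW t ` {0..g} \<union> sqB (t - 1) ` S \<union> sqB t ` insert 0 T"
      by (simp add: row_def)
    have "num_tilings (row t S T' g (int n)) =
        num_tilings (row t S T' g (int n) - {sqB t 0, sqW t 0})"
      by (rule num_tilings_forced[OF finite_row]) (use that S0 in \<open>auto simp: r\<close>)
    also have "row t S T' g (int n) - {sqB t 0, sqW t 0} =
        sqW t ` {c..g} \<union> sqB (t - 1) ` S \<union> sqB t ` T"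
      using S0 c1 by (auto simp: r)
    finally show ?thesis .
  qed
  show "num_tilings (sqW t ` {c..int n} \<union> sqB (t - 1) ` S \<union> sqB t ` T) =
      (if (\<forall>i\<le>n. D i \<in> {0, 1}) \<and> D n = 1 then 2 ^ card (S \<inter> T) else 0)"
    using row_count(1)[OF S0(1), of t T' n] whites[of "int n"] unfolding D d by simp
  show "num_tilings (sqW t ` {c..int n - 1} \<union> sqB (t - 1) ` S \<union> sqB t ` T) =
      (if (\<forall>i\<le>n. D i \<in> {0, 1}) \<and> D n = 0 then 2 ^ card (S \<inter> T) else 0)" if "n \<ge> 1"
    using row_count(2)[OF S0(1), of t T' n] whites[of "int n - 1"] that unfolding D d by simp
qed

text \<open>
  The white squares of the row have to cover \<open>A\<close> in the black row before it and everything except \<open>U\<close>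
  in the black row after it; \<open>U\<close> is left to the rows beyond. Hence the double positions are \<open>A - U\<close> and the excess at \<open>i\<close> is \<open>c\<close> plus the
  number of elements of \<open>A\<close> minus the number of elements of \<open>U\<close> up to \<open>i\<close>.
\<close>

lemma num_tilings_full_row:
  assumes c: "c \<in> {0, 1}" and AU: "A \<subseteq> {1..int n}" "U \<subseteq> {1..int n}"
  shows "num_tilings (sqW t ` {c..int n} \<union> sqB (t - 1) ` A \<union> sqB t ` ({1..int n} - U)) =
    (if interlaced c A U then 2 ^ card (A - U) else 0)"
proof -
  have "A \<inter> ({1..int n} - U) = A - U" using AU by auto
  then show ?thesis
    using num_tilings_row(1)[OF c AU(1), of "{1..int n} - U" t]
    by (simp add: interlaced_truncate[OF AU] card_complement_prefix algebra_simps)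
qed

text \<open>
  The same for a row without its rightmost white square, where \<open>A\<close> and \<open>U\<close> are the complements of
  the sets they were in the untrimmed row. Complementing both sets changes the sign of the difference
  of the counts. The present and absent leftmost square change roles, so the excess turns from \<open>x\<close>
  into \<open>1 - x\<close> and the same interlacing condition results, but now the double positions are
  \<open>U - A\<close>.
\<close>

lemma num_tilings_trimmed_row:
  assumes c: "c \<in> {0, 1}" and AU: "A \<subseteq> {1..int n}" "U \<subseteq> {1..int n}" and n: "n \<ge> 1"
  shows "num_tilings (sqW t ` {1 - c..int n - 1} \<union> sqB (t - 1) ` ({1..int n} - A) \<union> sqB t ` U) =
    (if interlaced c A U then 2 ^ card (U - A) else 0)"
proof -
  have d: "({1..int n} - A) \<inter> U = U - A" using AU by auto
  have c': "1 - c \<in> {0, 1}" using c by auto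
  have D: "1 - c + int (card (({1..int n} - A) \<inter> {1..int i})) + int (card (U \<inter> {1..int i})) - int i
     = 1 - (c + int (card (A \<inter> {1..int i})) - int (card (U \<inter> {1..int i})))" if "i \<le> n" for i
    using card_complement_prefix[OF that, of A] by simp
  have flip: "1 - x \<in> {0, 1} \<longleftrightarrow> x \<in> {0, 1}" "1 - x = 0 \<longleftrightarrow> x = 1" for x :: int by auto
  show ?thesis
    using num_tilings_row(2)[OF c' _ AU(2) n, of "{1..int n} - A" t]
    by (simp add: interlaced_truncate[OF AU] d D flip del: insert_iff cong: conj_cong all_cong1 imp_cong)
qed

section \<open>Stacks of rows\<close>

text \<open>
  The part of a region from the black row \<open>s\<close> on: \<open>S\<close> are the squares of that row which the later
  rows have to cover, \<open>l t\<close> is the first white square of row \<open>t\<close>, \<open>g\<close> the last one of every row,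
  and \<open>V t\<close> the black squares of row \<open>t\<close>.
\<close>

definition stack :: "int \<Rightarrow> (int \<Rightarrow> int) \<Rightarrow> int \<Rightarrow> (int \<Rightarrow> int set) \<Rightarrow> int \<Rightarrow> int set \<Rightarrow> square set" where
  "stack m l g V s S = sqB s ` S \<union> (\<Union>t\<in>{s<..m}. sqW t ` {l t..g} \<union> sqB t ` V t)"

lemma num_tilings_stack_top:
  assumes "finite S"
  shows "num_tilings (stack m l g V m S) = of_bool (S = {})"
proof (cases "S = {}")
  case True
  then show ?thesis by (simp add: stack_def)
next
  case False
  then obtain j where j: "j \<in> S" by blast
  have "num_tilings (sqB m ` S) = 0"
    by (rule num_tilings_isolated[of _ "sqB m j"]) (use assms j in auto)
  then show ?thesis using False by (simp add: stack_def)
qed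

lemma sum_Pow_image:
  assumes "inj_on f A"
  shows "(\<Sum>T \<in> Pow (f ` A). g T) = (\<Sum>T \<in> Pow A. g (f ` T))"
  using sum.reindex[OF inj_on_image_Pow[OF assms], of g] image_Pow_surj[of f A "f ` A"]
  by (simp add: comp_def)

lemma num_tilings_stack:
  assumes "s < m" "finite S" "\<And>t. finite (V t)"
  shows "num_tilings (stack m l g V s S) =
    (\<Sum>T \<in> Pow (V (s + 1)).
       num_tilings (sqW (s + 1) ` {l (s + 1)..g} \<union> sqB s ` S \<union> sqB (s + 1) ` T) *
       num_tilings (stack m l g V (s + 1) (V (s + 1) - T)))"
proof -
  let ?L = "sqW (s + 1) ` {l (s + 1)..g} \<union> sqB s ` S" and ?M = "sqB (s + 1) ` V (s + 1)"
  let ?U = "\<Union>t\<in>{s + 1<..m}. sqW t ` {l t..g} \<union> sqB t ` V t"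
  have inj: "inj_on (sqB (s + 1)) X" for X by (rule inj_onI) simp
  have rest: "(?M - sqB (s + 1) ` T) \<union> ?U = stack m l g V (s + 1) (V (s + 1) - T)" for T
    unfolding stack_def by (rule arg_cong[where f = "\<lambda>X. X \<union> ?U"]) auto
  have "{s<..m} = insert (s + 1) {s + 1<..m}" using assms by auto
  then have "stack m l g V s S = ?L \<union> ?M \<union> ?U" by (auto simp: stack_def)
  then have "num_tilings (stack m l g V s S) = num_tilings (?L \<union> ?M \<union> ?U)" by (rule arg_cong)
  also have "\<dots> =
      (\<Sum>T \<in> Pow ?M. num_tilings (?L \<union> T) * num_tilings ((?M - T) \<union> ?U))"
    by (rule num_tilings_separator) (use assms in auto)
  also have "\<dots> = (\<Sum>T \<in> Pow (V (s + 1)). num_tilings (?L \<union> sqB (s + 1) ` T) *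
       num_tilings ((?M - sqB (s + 1) ` T) \<union> ?U))"
    by (rule sum_Pow_image[OF inj])
  also have "\<dots> = (\<Sum>T \<in> Pow (V (s + 1)). num_tilings (?L \<union> sqB (s + 1) ` T) *
       num_tilings (stack m l g V (s + 1) (V (s + 1) - T)))"
    by (rule sum.cong[OF refl]) (simp only: rest)
  finally show ?thesis .
qed

text \<open>
  Every square is white or black, by the parity of the sum of its coordinates.
\<close>

lemma region_eqI:
  assumes "\<And>t c. sqW t c \<in> X \<longleftrightarrow> sqW t c \<in> Y" and "\<And>i j. sqB i j \<in> X \<longleftrightarrow> sqB i j \<in> Y"
  shows "X = Y"
proof (rule set_eqI)
  fix s :: square
  obtain x y where s: "s = (x, y)" by (cases s)
  show "s \<in> X \<longleftrightarrow> s \<in> Y"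
  proof (cases "even (x + y)")
    case True
    then obtain j where "x + y = 2 * j" by (rule evenE)
    then have "s = sqB (j - x) j" by (simp add: s sqB_def)
    then show ?thesis using assms(2) by simp
  next
    case False
    then obtain c where "x + y = 2 * c + 1" by (rule oddE)
    then have "s = sqW (c + 1 - x) c" by (simp add: s sqW_def)
    then show ?thesis using assms(1) by simp
  qed
qed

lemma mem_AR:
  "sqW t c \<in> AR m n \<longleftrightarrow> 1 \<le> t \<and> t \<le> int m \<and> 0 \<le> c \<and> c \<le> int n"
  "sqB i j \<in> AR m n \<longleftrightarrow> 0 \<le> i \<and> i \<le> int m \<and> 1 \<le> j \<and> j \<le> int n"
  unfolding AR_def by simp_all

lemma mem_TR:
  "sqW t c \<in> TR m n \<longleftrightarrow> 1 \<le> t \<and> t \<le> int m \<and> 0 \<le> c \<and> c < int n"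
  "sqB i j \<in> TR m n \<longleftrightarrow> 0 \<le> i \<and> i < int m \<and> 1 \<le> j \<and> j \<le> int n"
  unfolding TR_def by (simp add: mem_AR; linarith)+

lemma mem_sides:
  "sqW t c \<in> SW_squares m Q \<longleftrightarrow> 1 \<le> t \<and> t \<le> int m \<and> Q t \<and> c = 0"
  "sqB i j \<notin> SW_squares m Q"
  "sqW t c \<notin> SE_squares n Q"
  "sqB i j \<in> SE_squares n Q \<longleftrightarrow> 1 \<le> j \<and> j \<le> int n \<and> Q j \<and> i = 0"
  unfolding SW_squares_def SE_squares_def by auto

lemma mem_stack:
  "sqW t c \<in> stack m l g V s S \<longleftrightarrow> s < t \<and> t \<le> m \<and> l t \<le> c \<and> c \<le> g"
  "sqB i j \<in> stack m l g V s S \<longleftrightarrow> i = s \<and> j \<in> S \<or> s < i \<and> i \<le> m \<and> j \<in> V i"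
proof -
  have "sqW t c \<in> sqW t' ` X \<longleftrightarrow> t = t' \<and> c \<in> X" "sqW t c \<notin> sqB t' ` X"
    "sqB i j \<in> sqB t' ` X \<longleftrightarrow> i = t' \<and> j \<in> X" "sqB i j \<notin> sqW t' ` X" for t' X
    by auto
  note images = this
  show "sqW t c \<in> stack m l g V s S \<longleftrightarrow> s < t \<and> t \<le> m \<and> l t \<le> c \<and> c \<le> g"
    "sqB i j \<in> stack m l g V s S \<longleftrightarrow> i = s \<and> j \<in> S \<or> s < i \<and> i \<le> m \<and> j \<in> V i"
    unfolding stack_def by (simp_all add: images)
qed

lemma AR_carved:
  assumes "A \<subseteq> {1..int n}"
  shows "AR m n - SW_squares m Q - SE_squares n (\<lambda>j. j \<notin> A) =
    stack (int m) (\<lambda>t. of_bool (Q t)) (int n) (\<lambda>_. {1..int n}) 0 A"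
proof (rule region_eqI)
  show "sqW t c \<in> AR m n - SW_squares m Q - SE_squares n (\<lambda>j. j \<notin> A) \<longleftrightarrow>
      sqW t c \<in> stack (int m) (\<lambda>t. of_bool (Q t)) (int n) (\<lambda>_. {1..int n}) 0 A" for t c
    by (cases "Q t") (simp add: mem_AR mem_sides mem_stack, linarith)+
  have "j \<in> A \<Longrightarrow> 1 \<le> j \<and> j \<le> int n" for j using assms by auto
  then show "sqB i j \<in> AR m n - SW_squares m Q - SE_squares n (\<lambda>j. j \<notin> A) \<longleftrightarrow>
      sqB i j \<in> stack (int m) (\<lambda>t. of_bool (Q t)) (int n) (\<lambda>_. {1..int n}) 0 A" for i j
    by (cases "i = 0"; cases "j \<in> A") (simp_all add: mem_AR mem_sides mem_stack, linarith+)
qed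

lemma TR_carved:
  assumes "m \<ge> 1"
  shows "TR m n - SW_squares m Q - SE_squares n (\<lambda>j. j \<in> A) =
    stack (int m) (\<lambda>t. of_bool (Q t)) (int n - 1) (\<lambda>t. if t = int m then {} else {1..int n}) 0
      ({1..int n} - A)"
    (is "?X = ?Y")
proof (rule region_eqI)
  show "sqW t c \<in> ?X \<longleftrightarrow> sqW t c \<in> ?Y" for t c
    by (cases "Q t") (simp add: mem_TR mem_sides mem_stack, linarith)+
  show "sqB i j \<in> ?X \<longleftrightarrow> sqB i j \<in> ?Y" for i j
    using assms
    by (cases "i = 0"; cases "j \<in> A"; cases "i = int m")
      (simp_all add: mem_TR mem_sides mem_stack, linarith+)
qed

section \<open>Rows of antisymmetric monotone triangles\<close>

definition antisym_row :: "nat \<Rightarrow> (nat \<Rightarrow> int) \<Rightarrow> bool" where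
  "antisym_row i r \<longleftrightarrow> (\<forall>j. \<not> (1 \<le> j \<and> j \<le> i) \<longrightarrow> r j = 0) \<and>
     (\<forall>j. 1 \<le> j \<and> j < i \<longrightarrow> r j < r (j + 1)) \<and>
     (\<forall>j. 1 \<le> j \<and> j \<le> i \<longrightarrow> r j = - r (i + 1 - j))"

definition positives :: "nat \<Rightarrow> (nat \<Rightarrow> int) \<Rightarrow> int set" where
  "positives i r = {x \<in> r ` {1..i}. x > 0}"

text \<open>
  Rows are compared through their counting functions, which turns inequalities between entries into
  inequalities between cardinalities.
\<close>

definition rank :: "nat \<Rightarrow> (nat \<Rightarrow> int) \<Rightarrow> int \<Rightarrow> nat" where
  "rank i r v = card {j \<in> {1..i}. r j \<le> v}"

lemma finite_positives [simp]: "finite (positives i r)"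
  by (simp add: positives_def)

lemma antisym_rowD:
  assumes "antisym_row i r"
  shows "\<not> (1 \<le> j \<and> j \<le> i) \<Longrightarrow> r j = 0" "1 \<le> j \<Longrightarrow> j < i \<Longrightarrow> r j < r (Suc j)"
    "1 \<le> j \<Longrightarrow> j \<le> i \<Longrightarrow> r j = - r (i + 1 - j)"
  using assms unfolding antisym_row_def Suc_eq_plus1 by blast+

lemma antisym_row_less:
  assumes r: "antisym_row i r" and "1 \<le> j" "j < j'" "j' \<le> i"
  shows "r j < r j'"
  using \<open>j < j'\<close> \<open>j' \<le> i\<close>
proof (induction j')
  case (Suc j')
  have "r j' < r (Suc j')"
    using antisym_rowD(2)[OF r, of j'] assms(2) Suc.prems by simp
  then show ?case using Suc by (cases "j = j'") auto
qed simp

lemma antisym_row_inj: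
  assumes "antisym_row i r"
  shows "inj_on r {1..i}"
proof (rule linorder_inj_onI)
  show "r x \<noteq> r y" if "x < y" "x \<in> {1..i}" "y \<in> {1..i}" for x y
    using antisym_row_less[OF assms, of x y] that by simp
qed auto

lemma le_rank_iff:
  assumes r: "antisym_row i r" and j: "1 \<le> j" "j \<le> i"
  shows "r j \<le> v \<longleftrightarrow> j \<le> rank i r v"
proof
  assume v: "r j \<le> v"
  have "r j' \<le> v" if "j' \<in> {1..j}" for j'
    using antisym_row_less[OF r, of j' j] that v j by (cases "j' = j") auto
  then have "{1..j} \<subseteq> {j' \<in> {1..i}. r j' \<le> v}" using j by auto
  then have "card {1..j} \<le> rank i r v" unfolding rank_def by (intro card_mono) auto
  then show "j \<le> rank i r v" by simp
next
  assume le: "j \<le> rank i r v"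
  show "r j \<le> v"
  proof (rule ccontr)
    assume v: "\<not> r j \<le> v"
    have "j' < j" if "j' \<in> {1..i}" "r j' \<le> v" for j'
      using antisym_row_less[OF r, of j j'] that v j by (cases "j' = j"; cases "j < j'") auto
    then have "{j' \<in> {1..i}. r j' \<le> v} \<subseteq> {1..<j}" by auto
    then have "rank i r v \<le> card {1..<j}" unfolding rank_def by (intro card_mono) auto
    then show False using le j by simp
  qed
qed

lemma card_reflect:
  assumes r: "antisym_row i r" and pq: "\<And>x. p x \<longleftrightarrow> q (- x)"
  shows "card {j \<in> {1..i}. p (r j)} = card {j \<in> {1..i}. q (r j)}"
proof -
  have neg: "r (Suc i - j) = - r j" if "Suc 0 \<le> j" "j \<le> i" for j
    using antisym_rowD(3)[OF r, of j] that by simp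
  have "bij_betw (\<lambda>j. Suc i - j) {j \<in> {1..i}. p (r j)} {j \<in> {1..i}. q (r j)}"
    by (rule bij_betw_byWitness[where f' = "\<lambda>j. Suc i - j"]) (auto simp: neg pq)
  then show ?thesis by (rule bij_betw_same_card)
qed

text \<open>
  Antisymmetry determines the counting function at negative values, so only its values at
  nonnegative integers, hence the positive entries, matter.
\<close>

lemma rank_reflect:
  assumes r: "antisym_row i r"
  shows "rank i r v + rank i r (- v - 1) = i"
proof -
  have "card {j \<in> {1..i}. r j \<le> - v - 1} = card {j \<in> {1..i}. r j > v}"
    by (rule card_reflect[OF r]) auto
  moreover have "card {j \<in> {1..i}. r j \<le> v} + card {j \<in> {1..i}. r j > v} =
      card ({j \<in> {1..i}. r j \<le> v} \<union> {j \<in> {1..i}. r j > v})"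
    by (intro card_Un_disjoint[symmetric]) auto
  moreover have "{j \<in> {1..i}. r j \<le> v} \<union> {j \<in> {1..i}. r j > v} = {1..i}" by auto
  ultimately show ?thesis by (simp add: rank_def)
qed

lemma card_positive_entries:
  assumes r: "antisym_row i r"
  shows "card {j \<in> {1..i}. r j > 0 \<and> p (r j)} = card {x \<in> positives i r. p x}"
proof -
  have inj: "inj_on r {j \<in> {1..i}. r j > 0 \<and> p (r j)}"
    by (rule inj_on_subset[OF antisym_row_inj[OF r]]) auto
  have "r ` {j \<in> {1..i}. r j > 0 \<and> p (r j)} = {x \<in> positives i r. p x}"
    unfolding positives_def by blast
  then show ?thesis using card_image[OF inj] by simp
qed

lemma card_positives:
  assumes r: "antisym_row i r"
  shows "card (positives i r) = i div 2"
proof -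
  let ?Z = "{j \<in> {1..i}. r j = 0}"
  have pos: "card {j \<in> {1..i}. r j > 0} = card (positives i r)"
    using card_positive_entries[OF r, of "\<lambda>_. True"] by simp
  have "rank i r 0 + rank i r (- 0 - 1) = i" by (rule rank_reflect[OF r])
  moreover have "rank i r (- 0 - 1) = card (positives i r)"
    unfolding pos[symmetric] rank_def by (rule card_reflect[OF r]) auto
  moreover have "rank i r 0 = card {j \<in> {1..i}. r j < 0} + card ?Z"
    unfolding rank_def by (subst card_Un_disjoint[symmetric]) (auto intro!: arg_cong[where f = card])
  moreover have "card {j \<in> {1..i}. r j < 0} = card (positives i r)"
    unfolding pos[symmetric] by (rule card_reflect[OF r]) auto
  moreover have "card ?Z \<le> 1"
  proof -
    have "card ?Z = card (r ` ?Z)"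
      by (rule card_image[symmetric], rule inj_on_subset[OF antisym_row_inj[OF r]]) auto
    also have "\<dots> \<le> card {0::int}" by (rule card_mono) auto
    finally show ?thesis by simp
  qed
  ultimately show ?thesis by linarith
qed

lemma rank_nonneg:
  assumes r: "antisym_row i r"
  shows "rank i r (int h) = i - i div 2 + card (positives i r \<inter> {1..int h})"
proof -
  have "card {j \<in> {1..i}. r j \<le> int h} =
      card ({j \<in> {1..i}. r j \<le> 0} \<union> {j \<in> {1..i}. r j > 0 \<and> r j \<le> int h})"
    by (rule arg_cong[where f = card]) auto
  also have "\<dots> = rank i r 0 + card {j \<in> {1..i}. r j > 0 \<and> r j \<le> int h}"
    unfolding rank_def by (rule card_Un_disjoint) auto
  also have "card {j \<in> {1..i}. r j > 0 \<and> r j \<le> int h} = card {x \<in> positives i r. x \<le> int h}"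
    by (rule card_positive_entries[OF r])
  also have "{x \<in> positives i r. x \<le> int h} = positives i r \<inter> {1..int h}"
    by (auto simp: positives_def)
  finally have "rank i r (int h) = rank i r 0 + card (positives i r \<inter> {1..int h})"
    by (simp add: rank_def)
  moreover have "rank i r 0 + rank i r (- 0 - 1) = i" by (rule rank_reflect[OF r])
  moreover have "rank i r (- 0 - 1) = card {j \<in> {1..i}. r j > 0}"
    unfolding rank_def by (rule card_reflect[OF r]) auto
  moreover have "card {j \<in> {1..i}. r j > 0} = i div 2"
    using card_positive_entries[OF r, of "\<lambda>_. True"] card_positives[OF r] by simp
  ultimately show ?thesis by simp
qed

lemma int_cases_reflect:
  obtains h where "v = int h" | h where "v = - int h - 1"
proof (cases "v \<ge> 0")
  case True
  then show ?thesis using that(1)[of "nat v"] by simp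
next
  case False
  then show ?thesis using that(2)[of "nat (- v - 1)"] by simp
qed

lemma antisym_row_eqI:
  assumes r: "antisym_row i r" and r': "antisym_row i r'" and eq: "positives i r = positives i r'"
  shows "r = r'"
proof
  fix j
  have rank: "rank i r v = rank i r' v" for v
  proof (cases v rule: int_cases_reflect)
    case (1 h)
    then show ?thesis using rank_nonneg[OF r] rank_nonneg[OF r'] eq by simp
  next
    case (2 h)
    then show ?thesis
      using rank_nonneg[OF r, of h] rank_nonneg[OF r', of h] eq
        rank_reflect[OF r, of "int h"] rank_reflect[OF r', of "int h"] by simp
  qed
  show "r j = r' j"
  proof (cases "1 \<le> j \<and> j \<le> i")
    case True
    then have "r j \<le> v \<longleftrightarrow> r' j \<le> v" for v
      using le_rank_iff[OF r] le_rank_iff[OF r'] rank by simp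
    then show ?thesis by (metis order_antisym order_refl)
  next
    case False
    then show ?thesis using antisym_rowD(1)[OF r] antisym_rowD(1)[OF r'] by metis
  qed
qed

text \<open>
  The row lists the set \<open>- S \<union> S\<close>, together with 0 if the length is odd, in increasing order;
  it is antisymmetric because reversing and negating this list gives the increasing list of the same
  set.
\<close>

lemma antisym_row_exists:
  assumes S: "finite S" "S \<subseteq> {1..}" "card S = i div 2"
  obtains r where "antisym_row i r" "positives i r = S"
proof -
  define Z where "Z = (if odd i then {0::int} else {})"
  define R where "R = uminus ` S \<union> Z \<union> S"
  define xs where "xs = sorted_list_of_set R"
  have fin: "finite R" by (simp add: R_def Z_def S)
  have pos: "x > 0" if "x \<in> S" for x using S(2) that by force
  have dis: "(uminus ` S \<union> Z) \<inter> S = {}" "uminus ` S \<inter> Z = {}"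
    by (auto simp: Z_def dest!: pos split: if_splits)
  have "card R = card (uminus ` S \<union> Z) + card S"
    unfolding R_def by (rule card_Un_disjoint) (use S dis in \<open>simp_all add: Z_def\<close>)
  also have "card (uminus ` S \<union> Z) = card (uminus ` S) + card Z"
    by (rule card_Un_disjoint) (use S dis in \<open>simp_all add: Z_def\<close>)
  also have "card (uminus ` S) = card S" by (rule card_image) simp
  also have "card S + card Z + card S = i"
    unfolding S(3) Z_def by (cases "odd i") (simp_all, presburger+)
  finally have len: "length xs = i" by (simp add: xs_def)
  have sorted: "sorted_wrt (<) xs" by (simp add: xs_def strict_sorted_iff)
  have set: "set xs = R" using fin by (simp add: xs_def)
  have "uminus ` R = R" by (auto simp: R_def Z_def image_Un image_image)
  then have "set (rev (map uminus xs)) = set xs" by (simp add: set)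
  moreover have "sorted_wrt (<) (rev (map uminus xs))"
    using sorted by (simp add: sorted_wrt_rev sorted_wrt_map)
  ultimately have mirror: "rev (map uminus xs) = xs"
    using sorted strict_sorted_equal by blast
  define r where "r = (\<lambda>j. if 1 \<le> j \<and> j \<le> i then xs ! (j - 1) else 0)"
  have image: "r ` {1..i} = R"
  proof -
    have "r ` {1..i} = (\<lambda>j. xs ! (j - 1)) ` {1..i}" by (rule image_cong) (auto simp: r_def)
    also have "\<dots> = (\<lambda>j. xs ! j) ` ((\<lambda>j. j - 1) ` {1..i})" by (simp add: image_image)
    also have "(\<lambda>j. j - 1) ` {1..i} = {0..<i}"
      by (force simp: image_iff intro: bexI[of _ "Suc _"])
    finally show ?thesis using nth_image[of i xs] len set by (simp add: lessThan_atLeast0)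
  qed
  have "antisym_row i r"
    unfolding antisym_row_def
  proof (intro conjI allI impI)
    fix j assume j: "1 \<le> j \<and> j < i"
    then show "r j < r (j + 1)"
      using sorted_wrt_nth_less[OF sorted, of "j - 1" j] len by (simp add: r_def)
  next
    fix j assume j: "1 \<le> j \<and> j \<le> i"
    then have lt: "j - 1 < i" by linarith
    have "xs ! (j - 1) = rev (map uminus xs) ! (j - 1)" by (simp add: mirror)
    also have "rev (map uminus xs) ! (j - 1) = - (xs ! (i - j))"
      using j len lt rev_nth[of "j - 1" "map uminus xs"] by simp
    finally have "xs ! (j - 1) = - (xs ! (i - j))" .
    moreover have "1 \<le> i + 1 - j" "i + 1 - j \<le> i" using j by linarith+
    ultimately show "r j = - r (i + 1 - j)" using j by (simp add: r_def)
  qed (auto simp: r_def)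
  moreover have "positives i r = S"
    unfolding positives_def image using pos by (force simp: R_def Z_def)
  ultimately show thesis by (rule that)
qed

text \<open>
  The rows satisfy the diagonal conditions iff at each \<open>v\<close> the counting function of the lower row
  exceeds that of the upper row by 0 or 1. By reflection it is enough to look at \<open>v \<ge> 0\<close>. There the
  nonpositive entries contribute \<open>i - i div 2\<close> to a row of length \<open>i\<close>; the difference of these
  contributions is the constant \<open>Suc i mod 2\<close>.
\<close>

lemma interlaced_rows_iff:
  assumes x: "antisym_row (Suc i) x" and y: "antisym_row i y"
  shows "(\<forall>j. 1 \<le> j \<and> j \<le> i \<longrightarrow> x j \<le> y j \<and> y j \<le> x (j + 1)) \<longleftrightarrow>
    interlaced (int (Suc i mod 2)) (positives (Suc i) x) (positives i y)" (is "?L \<longleftrightarrow> ?R")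
proof -
  let ?near = "\<lambda>v. rank i y v \<le> rank (Suc i) x v \<and> rank (Suc i) x v \<le> rank i y v + 1"
  have yi: "rank i y v \<le> i" for v using rank_reflect[OF y, of v] by simp
  have xi: "rank (Suc i) x v \<le> Suc i" for v using rank_reflect[OF x, of v] by simp
  have "?L \<longleftrightarrow> (\<forall>v. ?near v)"
  proof
    assume L: ?L
    show "\<forall>v. ?near v"
    proof (intro allI conjI)
      fix v
      show "rank i y v \<le> rank (Suc i) x v"
      proof (cases "rank i y v = 0")
        case False
        define j where "j = rank i y v"
        have j: "1 \<le> j" "j \<le> i" using False yi by (simp_all add: j_def)
        have "y j \<le> v" using le_rank_iff[OF y j] by (simp add: j_def)
        then have "x j \<le> v" using L j by force
        then show ?thesis using le_rank_iff[OF x, of j v] j by (simp add: j_def)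
      qed simp
      show "rank (Suc i) x v \<le> rank i y v + 1"
      proof (cases "rank (Suc i) x v \<le> 1")
        case False
        define j where "j = rank (Suc i) x v - 1"
        have j: "1 \<le> j" "j \<le> i" "rank (Suc i) x v = j + 1"
          using False xi[of v] by (simp_all add: j_def)
        have "x (j + 1) \<le> v" using le_rank_iff[OF x, of "j + 1" v] j by simp
        then have "y j \<le> v" using L j by force
        then show ?thesis using le_rank_iff[OF y, of j v] j by simp
      qed simp
    qed
  next
    assume near: "\<forall>v. ?near v"
    show ?L
    proof (intro allI impI)
      fix j assume j: "1 \<le> j \<and> j \<le> i"
      have "j \<le> rank i y (y j)" using le_rank_iff[OF y, of j "y j"] j by simp
      then have "j \<le> rank (Suc i) x (y j)" using near order_trans by blast
      then have "x j \<le> y j" using le_rank_iff[OF x, of j "y j"] j by simp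
      moreover have "j + 1 \<le> rank (Suc i) x (x (j + 1))"
        using le_rank_iff[OF x, of "j + 1" "x (j + 1)"] j by simp
      then have "j \<le> rank i y (x (j + 1))" using near order_trans by fastforce
      then have "y j \<le> x (j + 1)" using le_rank_iff[OF y, of j "x (j + 1)"] j by simp
      ultimately show "x j \<le> y j \<and> y j \<le> x (j + 1)" ..
    qed
  qed
  also have "\<dots> \<longleftrightarrow> (\<forall>h. ?near (int h))"
  proof (intro iffI allI)
    fix v assume near: "\<forall>h. ?near (int h)"
    show "?near v"
    proof (cases v rule: int_cases_reflect)
      case (1 h)
      then show ?thesis using near by simp
    next
      case (2 h)
      then show ?thesis
        using spec[OF near, of h] rank_reflect[OF x, of "int h"] rank_reflect[OF y, of "int h"]
        by simp
    qed
  qed simp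
  also have "\<dots> \<longleftrightarrow> ?R"
  proof -
    have 1: "int (Suc i mod 2) + int (Suc i div 2) = int (i div 2) + 1"
      by (cases "even i") (auto elim!: evenE oddE)
    have 2: "int (rank (Suc i) x (int h)) - int (rank i y (int h)) = int (Suc i mod 2) +
        int (card (positives (Suc i) x \<inter> {1..int h})) - int (card (positives i y \<inter> {1..int h}))" for h
    proof -
      have "int (Suc i - Suc i div 2) - int (i - i div 2) = int (Suc i mod 2)"
        by (cases "even i") (auto elim!: evenE oddE)
      then show ?thesis unfolding rank_nonneg[OF x] rank_nonneg[OF y] by simp
    qed
    have "?near (int h) \<longleftrightarrow> int (rank (Suc i) x (int h)) - int (rank i y (int h)) \<in> {0, 1}" for h
      by auto
    then show ?thesis
      unfolding interlaced_def card_positives[OF x] card_positives[OF y] 2 using 1 by simp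
  qed
  finally show ?thesis .
qed

section \<open>Peeling off the bottom row\<close>

definition AMTs :: "nat \<Rightarrow> int set \<Rightarrow> (nat \<Rightarrow> nat \<Rightarrow> int) set" where
  "AMTs N S = {a. AMT N a \<and> positives N (a N) = S}"

lemma AMT_iff_rows:
  "AMT N a \<longleftrightarrow> (\<forall>i. \<not> (1 \<le> i \<and> i \<le> N) \<longrightarrow> a i = (\<lambda>_. 0)) \<and>
     (\<forall>i. 1 \<le> i \<and> i \<le> N \<longrightarrow> antisym_row i (a i)) \<and>
     (\<forall>i. i < N \<longrightarrow> (\<forall>j. 1 \<le> j \<and> j \<le> i \<longrightarrow> a (Suc i) j \<le> a i j \<and> a i j \<le> a (Suc i) (j + 1)))"
  (is "?L \<longleftrightarrow> ?R")
proof
  assume ?L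
  then have 0: "\<And>i j. \<not> (1 \<le> j \<and> j \<le> i \<and> i \<le> N) \<Longrightarrow> a i j = 0"
    and inc: "\<And>i j. 1 \<le> j \<and> j < i \<and> i \<le> N \<Longrightarrow> a i j < a i (j + 1)"
    and diag: "\<And>i j. 1 \<le> j \<and> j \<le> i \<and> i < N \<Longrightarrow> a (i + 1) j \<le> a i j \<and> a i j \<le> a (i + 1) (j + 1)"
    and anti: "\<And>i j. 1 \<le> j \<and> j \<le> i \<and> i \<le> N \<Longrightarrow> a i j = - a i (i + 1 - j)"
    unfolding AMT_def monotone_triangle_def by blast+
  have "a i = (\<lambda>_. 0)" if "\<not> (1 \<le> i \<and> i \<le> N)" for i
    by (rule ext, rule 0) (use that in linarith)
  moreover have "antisym_row i (a i)" if "1 \<le> i \<and> i \<le> N" for i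
    unfolding antisym_row_def
  proof (intro conjI allI impI)
    show "a i j = 0" if "\<not> (1 \<le> j \<and> j \<le> i)" for j by (rule 0) (use that in blast)
    show "a i j < a i (j + 1)" if "1 \<le> j \<and> j < i" for j
      by (rule inc) (use that \<open>1 \<le> i \<and> i \<le> N\<close> in blast)
    show "a i j = - a i (i + 1 - j)" if "1 \<le> j \<and> j \<le> i" for j
      by (rule anti) (use that \<open>1 \<le> i \<and> i \<le> N\<close> in blast)
  qed
  moreover have "a (Suc i) j \<le> a i j \<and> a i j \<le> a (Suc i) (j + 1)"
    if "i < N" "1 \<le> j \<and> j \<le> i" for i j
    using diag[of j i] that by simp
  ultimately show ?R by blast
next
  assume R: ?R
  then have 0: "a i = (\<lambda>_. 0)" if "\<not> (1 \<le> i \<and> i \<le> N)" for i using that by blast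
  have row: "antisym_row i (a i)" if "1 \<le> i" "i \<le> N" for i using R that by blast
  show ?L
    unfolding AMT_def monotone_triangle_def
  proof (intro conjI allI impI)
    fix i j assume out: "\<not> (1 \<le> j \<and> j \<le> i \<and> i \<le> N)"
    show "a i j = 0"
    proof (cases "1 \<le> i \<and> i \<le> N")
      case True
      then show ?thesis using antisym_rowD(1)[OF row, of i j] out by blast
    next
      case False
      then show ?thesis using 0 by simp
    qed
  next
    fix i j assume "1 \<le> j \<and> j < i \<and> i \<le> N"
    then show "a i j < a i (j + 1)" using antisym_rowD(2)[OF row, of i j] by simp
  next
    fix i j assume j: "1 \<le> j \<and> j \<le> i \<and> i < N"
    then have "a (Suc i) j \<le> a i j \<and> a i j \<le> a (Suc i) (j + 1)" using R by blast
    then show "a (i + 1) j \<le> a i j" "a i j \<le> a (i + 1) (j + 1)" by simp_all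
  next
    fix i j assume "1 \<le> j \<and> j \<le> i \<and> i \<le> N"
    then show "a i j = - a i (i + 1 - j)" by (intro antisym_rowD(3) row) linarith+
  qed
qed

lemma AMT_row_antisym:
  assumes "AMT N a"
  shows "antisym_row N (a N)"
proof (cases "N = 0")
  case True
  then have "a N = (\<lambda>_. 0)" using assms unfolding AMT_iff_rows by simp
  with True show ?thesis by (simp add: antisym_row_def)
qed (use assms in \<open>simp add: AMT_iff_rows\<close>)

lemma AMT_Suc_iff:
  "AMT (Suc N) (a(Suc N := r)) \<and> a (Suc N) = (\<lambda>_. 0) \<longleftrightarrow>
    AMT N a \<and> antisym_row (Suc N) r \<and>
    (\<forall>j. 1 \<le> j \<and> j \<le> N \<longrightarrow> r j \<le> a N j \<and> a N j \<le> r (j + 1))"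
  (is "?L \<longleftrightarrow> ?R")
proof
  assume L: ?L
  let ?b = "a(Suc N := r)"
  from L have b0: "\<And>i. \<not> (1 \<le> i \<and> i \<le> Suc N) \<Longrightarrow> ?b i = (\<lambda>_. 0)"
    and brow: "\<And>i. 1 \<le> i \<and> i \<le> Suc N \<Longrightarrow> antisym_row i (?b i)"
    and bdiag: "\<And>i j. i < Suc N \<Longrightarrow> 1 \<le> j \<and> j \<le> i \<Longrightarrow>
      ?b (Suc i) j \<le> ?b i j \<and> ?b i j \<le> ?b (Suc i) (j + 1)"
    unfolding AMT_iff_rows by blast+
  have "a i = (\<lambda>_. 0)" if "\<not> (1 \<le> i \<and> i \<le> N)" for i
    using b0[of i] that L by (cases "i = Suc N") auto
  moreover have "antisym_row i (a i)" if "1 \<le> i \<and> i \<le> N" for i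
    using brow[of i] that by simp
  moreover have "a (Suc i) j \<le> a i j \<and> a i j \<le> a (Suc i) (j + 1)"
    if "i < N" "1 \<le> j \<and> j \<le> i" for i j
    using bdiag[of i j] that by simp
  moreover have "antisym_row (Suc N) r" using brow[of "Suc N"] by simp
  moreover have "r j \<le> a N j \<and> a N j \<le> r (j + 1)" if "1 \<le> j \<and> j \<le> N" for j
    using bdiag[of N j] that by simp
  ultimately show ?R unfolding AMT_iff_rows by blast
next
  assume R: ?R
  then have "a (Suc N) = (\<lambda>_. 0)" unfolding AMT_iff_rows by simp
  moreover have "AMT (Suc N) (a(Suc N := r))"
    unfolding AMT_iff_rows
  proof (intro conjI allI impI)
    fix i assume "\<not> (1 \<le> i \<and> i \<le> Suc N)"
    then show "(a(Suc N := r)) i = (\<lambda>_. 0)" using R unfolding AMT_iff_rows by auto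
  next
    fix i assume "1 \<le> i \<and> i \<le> Suc N"
    then show "antisym_row i ((a(Suc N := r)) i)"
      using R unfolding AMT_iff_rows by (cases "i = Suc N") auto
  next
    fix i j assume "i < Suc N" "1 \<le> j \<and> j \<le> i"
    then show "(a(Suc N := r)) (Suc i) j \<le> (a(Suc N := r)) i j"
      "(a(Suc N := r)) i j \<le> (a(Suc N := r)) (Suc i) (j + 1)"
      using R unfolding AMT_iff_rows by (cases "i = N"; simp)+
  qed
  ultimately show ?L by blast
qed

text \<open>
  The positive entries of the bottom row determine that row, so a triangle of order \<open>Suc N\<close> with
  given positive bottom entries is nothing but a compatible triangle of order \<open>N\<close>.
\<close>

lemma AMTs_Suc:
  assumes r: "antisym_row (Suc N) r" "positives (Suc N) r = S" and S: "S \<subseteq> {1..int n}"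
  shows "AMTs (Suc N) S = (\<lambda>a. a(Suc N := r)) `
    (\<Union>U \<in> {U \<in> Pow {1..int n}. interlaced (int (Suc N mod 2)) S U}. AMTs N U)"
proof (intro equalityI subsetI)
  fix b assume b: "b \<in> AMTs (Suc N) S"
  define a where "a = b(Suc N := \<lambda>_. 0)"
  have "AMT (Suc N) b" "positives (Suc N) (b (Suc N)) = S" using b by (simp_all add: AMTs_def)
  then have bN: "b (Suc N) = r" by (intro antisym_row_eqI[OF AMT_row_antisym r(1)]) (simp_all add: r)
  then have ba: "b = a(Suc N := r)" "a (Suc N) = (\<lambda>_. 0)" by (auto simp: a_def)
  then have a: "AMT N a" "\<forall>j. 1 \<le> j \<and> j \<le> N \<longrightarrow> r j \<le> a N j \<and> a N j \<le> r (j + 1)"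
    using AMT_Suc_iff[of N a r] \<open>AMT (Suc N) b\<close> by simp_all
  let ?U = "positives N (a N)"
  have int: "interlaced (int (Suc N mod 2)) S ?U"
    using interlaced_rows_iff[OF r(1) AMT_row_antisym[OF a(1)]] a(2) r(2) by simp
  moreover have "?U \<subseteq> {1..int n}"
    by (rule interlaced_bounded[OF int S]) (auto simp: positives_def)
  moreover have "a \<in> AMTs N ?U" using a by (simp add: AMTs_def)
  ultimately show "b \<in> (\<lambda>a. a(Suc N := r)) `
    (\<Union>U \<in> {U \<in> Pow {1..int n}. interlaced (int (Suc N mod 2)) S U}. AMTs N U)"
    unfolding ba(1) by blast
next
  fix b assume "b \<in> (\<lambda>a. a(Suc N := r)) `
    (\<Union>U \<in> {U \<in> Pow {1..int n}. interlaced (int (Suc N mod 2)) S U}. AMTs N U)"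
  then obtain a where b: "b = a(Suc N := r)" and a: "AMT N a"
    and int: "interlaced (int (Suc N mod 2)) S (positives N (a N))"
    by (auto simp: AMTs_def)
  have "\<forall>j. 1 \<le> j \<and> j \<le> N \<longrightarrow> r j \<le> a N j \<and> a N j \<le> r (j + 1)"
    using interlaced_rows_iff[OF r(1) AMT_row_antisym[OF a]] int r(2) by simp
  then have "AMT (Suc N) b" using AMT_Suc_iff[of N a r] a r b by simp
  then show "b \<in> AMTs (Suc N) S" using b r(2) by (simp add: AMTs_def)
qed

lemma finite_AMTs: "S \<subseteq> {1..int n} \<Longrightarrow> finite (AMTs N S)"
proof (induction N arbitrary: S)
  case 0
  have "AMTs 0 S \<subseteq> {\<lambda>_ _. 0}" by (auto simp: AMTs_def AMT_iff_rows)
  then show ?case by (rule finite_subset) simp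
next
  case (Suc N)
  show ?case
  proof (cases "AMTs (Suc N) S = {}")
    case False
    then obtain b where "AMT (Suc N) b" "positives (Suc N) (b (Suc N)) = S"
      by (auto simp: AMTs_def)
    then show ?thesis
      using AMTs_Suc[OF AMT_row_antisym _ Suc.prems, of N b] Suc.IH
      by (simp add: finite_Pow_iff)
  qed simp
qed

lemma new_positive_entries_Suc:
  assumes a: "AMT N a" and r: "antisym_row (Suc N) r"
  shows "new_positive_entries (Suc N) (a(Suc N := r)) =
    new_positive_entries N a + card (positives (Suc N) r - positives N (a N))"
proof -
  let ?old = "{(i, j). 1 \<le> j \<and> j \<le> i \<and> i \<le> N \<and> a i j > 0 \<and> a i j \<notin> a (i - 1) ` {1..i - 1}}"
  let ?J = "{j \<in> {1..Suc N}. r j > 0 \<and> r j \<notin> positives N (a N)}"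
  let ?b = "a(Suc N := r)"
  have "1 \<le> j \<and> j \<le> i \<and> i \<le> Suc N \<and> ?b i j > 0 \<and> ?b i j \<notin> ?b (i - 1) ` {1..i - 1} \<longleftrightarrow>
      (i, j) \<in> ?old \<union> Pair (Suc N) ` ?J" for i j
  proof (cases "i = Suc N")
    case True
    then show ?thesis by (auto simp: positives_def)
  next
    case False
    have "i - 1 \<noteq> Suc N" if "i \<le> Suc N" using that by simp
    with False show ?thesis by (auto simp: le_Suc_eq)
  qed
  then have "{(i, j). 1 \<le> j \<and> j \<le> i \<and> i \<le> Suc N \<and> ?b i j > 0 \<and> ?b i j \<notin> ?b (i - 1) ` {1..i - 1}} =
      ?old \<union> Pair (Suc N) ` ?J" by blast
  moreover have "finite ?old"
    by (rule finite_subset[of _ "{1..N} \<times> {1..N}"]) auto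
  moreover have "?old \<inter> Pair (Suc N) ` ?J = {}" by auto
  ultimately have "new_positive_entries (Suc N) (a(Suc N := r)) =
      card ?old + card (Pair (Suc N) ` ?J)"
    unfolding new_positive_entries_def by (simp add: card_Un_disjoint)
  also have "card (Pair (Suc N) ` ?J) = card ?J" by (rule card_image) (simp add: inj_on_def)
  also have "card ?J = card {x \<in> positives (Suc N) r. x \<notin> positives N (a N)}"
    by (rule card_positive_entries[OF r])
  also have "{x \<in> positives (Suc N) r. x \<notin> positives N (a N)} =
      positives (Suc N) r - positives N (a N)" by auto
  finally show ?thesis by (simp only: new_positive_entries_def)
qed

definition weight_sum :: "real \<Rightarrow> nat \<Rightarrow> int set \<Rightarrow> real" where
  "weight_sum q N S = (\<Sum>a \<in> AMTs N S. q ^ new_positive_entries N a)"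

lemma q_enumeration_eq: "q_enumeration q N b = weight_sum q N (b ` {1..N div 2})"
  by (simp add: q_enumeration_def weight_sum_def AMTs_def positives_def)

text \<open>
  The new positive entries of the bottom row are \<open>S - U\<close>. The formula holds for sets \<open>S\<close> of any size:
  if \<open>S\<close> has the wrong size for a bottom row, then so has every \<open>U\<close> that interlaces with it, and both
  sides are 0.
\<close>

lemma weight_sum_Suc:
  assumes S: "S \<subseteq> {1..int n}"
  shows "weight_sum q (Suc N) S = (\<Sum>U \<in> Pow {1..int n}.
    if interlaced (int (Suc N mod 2)) S U then q ^ card (S - U) * weight_sum q N U else 0)"
proof -
  let ?I = "{U \<in> Pow {1..int n}. interlaced (int (Suc N mod 2)) S U}"
  have "weight_sum q (Suc N) S = (\<Sum>U\<in>?I. q ^ card (S - U) * weight_sum q N U)"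
  proof (cases "card S = Suc N div 2")
    case True
    have "finite S" using S finite_subset by blast
    moreover have "S \<subseteq> {1..}" using S by auto
    ultimately obtain r where r: "antisym_row (Suc N) r" "positives (Suc N) r = S"
      using antisym_row_exists[of S "Suc N"] True by blast
    have fin: "finite (AMTs N U)" if "U \<in> ?I" for U using that finite_AMTs by auto
    have inj: "inj_on (\<lambda>a. a(Suc N := r)) (\<Union>U\<in>?I. AMTs N U)"
    proof (rule inj_onI)
      fix a b assume "a \<in> (\<Union>U\<in>?I. AMTs N U)" "b \<in> (\<Union>U\<in>?I. AMTs N U)"
        and eq: "a(Suc N := r) = b(Suc N := r)"
      then have "a (Suc N) = b (Suc N)" by (auto simp: AMTs_def AMT_iff_rows)
      then show "a = b" using eq by (metis fun_upd_triv fun_upd_upd)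
    qed
    have "weight_sum q (Suc N) S =
        (\<Sum>a \<in> (\<Union>U\<in>?I. AMTs N U). q ^ new_positive_entries (Suc N) (a(Suc N := r)))"
      unfolding weight_sum_def AMTs_Suc[OF r S] sum.reindex[OF inj] comp_def ..
    also have "\<dots> = (\<Sum>U\<in>?I. \<Sum>a\<in>AMTs N U. q ^ new_positive_entries (Suc N) (a(Suc N := r)))"
      by (rule sum.UNION_disjoint) (use fin in \<open>auto simp: AMTs_def\<close>)
    also have "\<dots> = (\<Sum>U\<in>?I. \<Sum>a\<in>AMTs N U. q ^ card (S - U) * q ^ new_positive_entries N a)"
      by (intro sum.cong refl)
        (auto simp: AMTs_def new_positive_entries_Suc[OF _ r(1)] r(2) power_add)
    finally show ?thesis by (simp add: weight_sum_def sum_distrib_left)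
  next
    case False
    then have "AMTs (Suc N) S = {}"
      using card_positives[OF AMT_row_antisym] by (auto simp: AMTs_def)
    then have "weight_sum q (Suc N) S = 0" by (simp add: weight_sum_def)
    moreover have "weight_sum q N U = 0" if U: "U \<in> ?I" for U
    proof -
      have "AMTs N U = {}"
      proof (rule ccontr)
        assume "AMTs N U \<noteq> {}"
        then have "card U = N div 2"
          using card_positives[OF AMT_row_antisym] by (auto simp: AMTs_def)
        moreover have "int (Suc N mod 2) + int (card S) = int (card U) + 1"
          using U by (simp add: interlaced_def)
        ultimately have "card S = Suc N div 2" by (cases "even N") (auto elim!: evenE oddE)
        then show False using False by contradiction
      qed
      then show ?thesis by (simp add: weight_sum_def)
    qed
    ultimately show ?thesis by simp
  qed
  also have "\<dots> = (\<Sum>U \<in> Pow {1..int n}.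
    if interlaced (int (Suc N mod 2)) S U then q ^ card (S - U) * weight_sum q N U else 0)"
    by (rule sum.inter_filter) simp
  finally show ?thesis .
qed

lemma weight_sum_0: "weight_sum q 0 S = of_bool (S = {})"
proof -
  have "AMTs 0 S = (if S = {} then {\<lambda>_ _. 0} else {})"
    by (auto simp: AMTs_def AMT_iff_rows positives_def)
  moreover have "new_positive_entries 0 (\<lambda>_ _. 0) = 0" by (simp add: new_positive_entries_def)
  ultimately show ?thesis by (simp add: weight_sum_def)
qed

text \<open>
  A triangle of order 1 contributes as little as the empty one. This is why regions with \<open>N - 1\<close> and
  with \<open>N\<close> rows of white squares have the same number of tilings.
\<close>

lemma weight_sum_1:
  assumes "S \<subseteq> {1..int n}"
  shows "weight_sum q 1 S = of_bool (S = {})"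
proof -
  have "weight_sum q (Suc 0) S = (\<Sum>U \<in> Pow {1..int n}.
      if interlaced 1 S U then q ^ card (S - U) * of_bool (U = {}) else 0)"
    unfolding weight_sum_Suc[OF assms] weight_sum_0 by simp
  also have "\<dots> = (\<Sum>U \<in> {{}}. if interlaced 1 S U then q ^ card (S - U) * of_bool (U = {}) else 0)"
    by (rule sum.mono_neutral_right) auto
  also have "\<dots> = of_bool (S = {})"
    using assms finite_subset[OF assms] by (auto simp: interlaced_def)
  finally show ?thesis by simp
qed

section \<open>Tilings and triangles satisfy the same recursion\<close>

lemma sum_Pow_complement: "(\<Sum>T \<in> Pow X. f T) = (\<Sum>U \<in> Pow X. f (X - U))"
  by (rule sum.reindex_bij_witness[of _ "\<lambda>T. X - T" "\<lambda>T. X - T"])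
    (auto simp: double_diff intro!: arg_cong[where f = f])

text \<open>
  White row \<open>s + 1\<close> corresponds to the step from row \<open>N - s\<close> of a triangle to the row above it.
  The alternate removal of the leftmost white squares matches the parity of the length of that row.
\<close>

lemma row_parity:
  assumes "s < N"
  shows "N - s = Suc (N - Suc s)"
    and "(int N - (int s + 1) + 1) mod 2 = int (Suc (N - Suc s) mod 2)"
    and "(int N - (int s + 1)) mod 2 = 1 - int (Suc (N - Suc s) mod 2)"
proof -
  define d where "d = N - Suc s"
  have d: "int N = int s + int d + 1" using assms by (simp add: d_def)
  show "N - s = Suc (N - Suc s)" using assms by simp
  have "(int N - (int s + 1) + 1) mod 2 = (int d + 1) mod 2" by (simp add: d)
  also have "\<dots> = int (Suc d mod 2)" by (simp add: zmod_int add.commute)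
  finally show "(int N - (int s + 1) + 1) mod 2 = int (Suc (N - Suc s) mod 2)" by (simp add: d_def)
  have "(int N - (int s + 1)) mod 2 = int d mod 2" by (simp add: d)
  also have "\<dots> = 1 - int (Suc d mod 2)" by presburger
  finally show "(int N - (int s + 1)) mod 2 = 1 - int (Suc (N - Suc s) mod 2)" by (simp add: d_def)
qed

text \<open>
  By \<open>num_tilings_stack\<close> and \<open>num_tilings_full_row\<close> the tilings satisfy the recursion of
  \<open>weight_sum_Suc\<close>. At the top of the region everything is covered iff no square is left over, and
  the remaining triangle of order 0 or 1 gives the same value.
\<close>

theorem num_tilings_full_stack:
  assumes N: "m \<le> N" "N \<le> m + 1" and l: "l = (\<lambda>t. (int N - t + 1) mod 2)"
    and "s \<le> m" and "A \<subseteq> {1..int n}"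
  shows "real (num_tilings (stack (int m) l (int n) (\<lambda>_. {1..int n}) (int s) A)) =
    weight_sum 2 (N - s) A"
  using \<open>s \<le> m\<close> \<open>A \<subseteq> {1..int n}\<close>
proof (induction s arbitrary: A rule: inc_induct)
  case base
  have "N - m = 0 \<or> N - m = 1" using N by linarith
  then show ?case
    using num_tilings_stack_top[OF finite_subset[OF base.prems finite_atLeastAtMost_int]]
      weight_sum_0 weight_sum_1[OF base.prems] by auto
next
  case (step s)
  let ?X = "{1..int n}" and ?c = "int (Suc (N - Suc s) mod 2)"
  let ?st = "\<lambda>s. stack (int m) l (int n) (\<lambda>_. {1..int n}) (int s)"
  have s: "s < N" using step N by simp
  have fin: "finite A" using step.prems finite_subset by blast
  have c: "l (int s + 1) = ?c" unfolding l by (rule row_parity(2)[OF s])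
  have c01: "?c \<in> {0, 1}" by auto
  have "num_tilings (?st s A) = (\<Sum>T \<in> Pow ?X.
      num_tilings (sqW (int s + 1) ` {?c..int n} \<union> sqB (int s) ` A \<union> sqB (int s + 1) ` T) *
      num_tilings (?st (Suc s) (?X - T)))"
    using num_tilings_stack[of "int s" "int m" A "\<lambda>_. ?X" l "int n"] step.hyps fin c
    by (simp add: add.commute)
  also have "\<dots> = (\<Sum>U \<in> Pow ?X.
      num_tilings (sqW (int s + 1) ` {?c..int n} \<union> sqB (int s) ` A \<union> sqB (int s + 1) ` (?X - U)) *
      num_tilings (?st (Suc s) (?X - (?X - U))))"
    by (rule sum_Pow_complement)
  also have "\<dots> = (\<Sum>U \<in> Pow ?X.
      (if interlaced ?c A U then 2 ^ card (A - U) else 0) * num_tilings (?st (Suc s) U))"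
  proof (rule sum.cong[OF refl])
    fix U assume "U \<in> Pow ?X"
    then have U: "U \<subseteq> ?X" "?X - (?X - U) = U" by auto
    show "num_tilings (sqW (int s + 1) ` {?c..int n} \<union> sqB (int s) ` A \<union> sqB (int s + 1) ` (?X - U)) *
      num_tilings (?st (Suc s) (?X - (?X - U))) =
      (if interlaced ?c A U then 2 ^ card (A - U) else 0) * num_tilings (?st (Suc s) U)"
      using num_tilings_full_row[OF c01 step.prems U(1), of "int s + 1"] U(2) by simp
  qed
  finally have "real (num_tilings (?st s A)) = (\<Sum>U \<in> Pow ?X.
      real (if interlaced ?c A U then 2 ^ card (A - U) else 0) * real (num_tilings (?st (Suc s) U)))"
    by simp
  also have "\<dots> = (\<Sum>U \<in> Pow ?X.
      if interlaced ?c A U then 2 ^ card (A - U) * weight_sum 2 (N - Suc s) U else 0)"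
    by (rule sum.cong[OF refl]) (use step.IH in auto)
  also have "\<dots> = weight_sum 2 (N - s) A"
    unfolding row_parity(1)[OF s] weight_sum_Suc[OF step.prems] ..
  finally show ?case .
qed

lemma card_add_card_Diff_commute:
  assumes "finite A" "finite B"
  shows "card A + card (B - A) = card B + card (A - B)"
  using assms card_Un_disjoint[of A "B - A"] card_Un_disjoint[of B "A - B"]
  by (simp add: Un_commute)

text \<open>
  A trimmed row has the weight exponent \<open>card (U - A)\<close> instead of \<open>card (A - U)\<close>. The two differ by
  \<open>card A - card U\<close>, which telescopes over the rows, and the topmost set is empty; so the correction
  factor is the power of 2 with the size of the first set as exponent.
\<close>

theorem num_tilings_trimmed_stack:
  assumes N: "m \<le> N" "N \<le> m + 1" and l: "l = (\<lambda>t. (int N - t) mod 2)"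
    and V: "V = (\<lambda>t. if t = int m then {} else {1..int n})" and n: "n \<ge> 1"
    and "s < m" and "A \<subseteq> {1..int n}"
  shows "real (num_tilings (stack (int m) l (int n - 1) V (int s) ({1..int n} - A))) * 2 ^ card A =
    weight_sum 2 (N - s) A"
  using \<open>s < m\<close> \<open>A \<subseteq> {1..int n}\<close>
proof (induction "m - s" arbitrary: s A rule: less_induct)
  case less
  let ?X = "{1..int n}" and ?c = "int (Suc (N - Suc s) mod 2)"
  let ?st = "\<lambda>s. stack (int m) l (int n - 1) V (int s)"
  have s: "s < N" using less.prems N by simp
  have fin: "finite A" using less.prems finite_subset by blast
  have c: "l (int s + 1) = 1 - ?c" unfolding l by (rule row_parity(3)[OF s])
  have c01: "?c \<in> {0, 1}" by auto
  have finV: "finite (V t)" for t by (simp add: V)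
  have expand: "num_tilings (?st s (?X - A)) = (\<Sum>U \<in> Pow (V (int s + 1)).
      (if interlaced ?c A U then 2 ^ card (U - A) else 0) *
      num_tilings (?st (Suc s) (V (int s + 1) - U)))"
  proof -
    have "num_tilings (?st s (?X - A)) = (\<Sum>U \<in> Pow (V (int s + 1)).
        num_tilings (sqW (int s + 1) ` {1 - ?c..int n - 1} \<union> sqB (int s) ` (?X - A) \<union>
          sqB (int s + 1) ` U) * num_tilings (?st (Suc s) (V (int s + 1) - U)))"
      using num_tilings_stack[of "int s" "int m" "?X - A" V l "int n - 1"] less.prems finV c
      by (simp add: add.commute)
    also have "\<dots> = (\<Sum>U \<in> Pow (V (int s + 1)).
        (if interlaced ?c A U then 2 ^ card (U - A) else 0) *
        num_tilings (?st (Suc s) (V (int s + 1) - U)))"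
    proof (rule sum.cong[OF refl])
      fix U assume "U \<in> Pow (V (int s + 1))"
      then have U: "U \<subseteq> ?X" by (auto simp: V split: if_splits)
      show "num_tilings (sqW (int s + 1) ` {1 - ?c..int n - 1} \<union> sqB (int s) ` (?X - A) \<union>
          sqB (int s + 1) ` U) * num_tilings (?st (Suc s) (V (int s + 1) - U)) =
        (if interlaced ?c A U then 2 ^ card (U - A) else 0) *
        num_tilings (?st (Suc s) (V (int s + 1) - U))"
        using num_tilings_trimmed_row[OF c01 less.prems(2) U n, of "int s + 1"] by simp
    qed
    finally show ?thesis .
  qed
  show ?case
  proof (cases "Suc s = m")
    case True
    have Vm: "V (int s + 1) = {}" using True by (simp add: V)
    have "N - m = 0 \<or> N - m = 1" using N by linarith
    then have top: "weight_sum 2 (N - Suc s) U = of_bool (U = {})" if "U \<subseteq> ?X" for U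
      using weight_sum_0[of 2 U] weight_sum_1[OF that, of 2] True by auto
    have "num_tilings (?st (Suc s) {}) = 1"
      using num_tilings_stack_top[of "{}" "int m" l "int n - 1" V] True by simp
    then have "num_tilings (?st s (?X - A)) = (if interlaced ?c A {} then 1 else 0)"
      unfolding expand Vm by simp
    moreover have "weight_sum 2 (N - s) A = (if interlaced ?c A {} then 2 ^ card A else 0)"
    proof -
      have "weight_sum 2 (N - s) A = (\<Sum>U \<in> Pow ?X.
          if interlaced ?c A U then 2 ^ card (A - U) * weight_sum 2 (N - Suc s) U else 0)"
        unfolding row_parity(1)[OF s] weight_sum_Suc[OF less.prems(2)] ..
      also have "\<dots> = (\<Sum>U \<in> {{}}.
          if interlaced ?c A U then 2 ^ card (A - U) * weight_sum 2 (N - Suc s) U else 0)"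
        by (rule sum.mono_neutral_right) (auto simp: top)
      finally show ?thesis by (simp add: top)
    qed
    ultimately show ?thesis by simp
  next
    case False
    then have s': "Suc s < m" using less.prems by simp
    have Vs: "V (int s + 1) = ?X" using s' by (simp add: V)
    have "real (num_tilings (?st s (?X - A))) * 2 ^ card A = (\<Sum>U \<in> Pow ?X.
        real (if interlaced ?c A U then 2 ^ card (U - A) else 0) *
        real (num_tilings (?st (Suc s) (?X - U))) * 2 ^ card A)"
      unfolding expand Vs by (simp add: sum_distrib_right)
    also have "\<dots> = (\<Sum>U \<in> Pow ?X.
        if interlaced ?c A U then 2 ^ card (A - U) * weight_sum 2 (N - Suc s) U else 0)"
    proof (rule sum.cong[OF refl])
      fix U assume "U \<in> Pow ?X"
      then have U: "U \<subseteq> ?X" and "finite U" using finite_subset by blast+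
      have "card A + card (U - A) = card U + card (A - U)"
        by (rule card_add_card_Diff_commute[OF fin \<open>finite U\<close>])
      then have weights: "(2::real) ^ card (U - A) * 2 ^ card A = 2 ^ card (A - U) * 2 ^ card U"
        unfolding power_add[symmetric] by (simp add: add.commute)
      have IH: "real (num_tilings (?st (Suc s) (?X - U))) * 2 ^ card U = weight_sum 2 (N - Suc s) U"
        by (rule less.hyps) (use s' U in auto)
      have "2 ^ card (U - A) * real (num_tilings (?st (Suc s) (?X - U))) * 2 ^ card A =
          2 ^ card (A - U) * weight_sum 2 (N - Suc s) U"
        unfolding IH[symmetric]
        using arg_cong[OF weights, of "\<lambda>x. x * real (num_tilings (?st (Suc s) (?X - U)))"]
        by (simp add: mult_ac)
      then show "real (if interlaced ?c A U then 2 ^ card (U - A) else 0) *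
          real (num_tilings (?st (Suc s) (?X - U))) * 2 ^ card A =
        (if interlaced ?c A U then 2 ^ card (A - U) * weight_sum 2 (N - Suc s) U else 0)"
        by simp
    qed
    also have "\<dots> = weight_sum 2 (N - s) A"
      unfolding row_parity(1)[OF s] weight_sum_Suc[OF less.prems(2)] ..
    finally show ?thesis .
  qed
qed

section \<open>The eight quartered Aztec rectangles\<close>

lemma num_tilings_quartered_AR:
  assumes "A \<subseteq> {1..int n}" "m \<le> N" "N \<le> m + 1"
    and "\<And>t. Q t \<longleftrightarrow> odd (int N - t + 1)"
  shows "real (num_tilings (AR m n - SW_squares m Q - SE_squares n (\<lambda>j. j \<notin> A))) = weight_sum 2 N A"
proof -
  have "(\<lambda>t. of_bool (Q t)) = (\<lambda>t. (int N - t + 1) mod 2)"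
    by (simp add: fun_eq_iff assms(4) odd_iff_mod_2_eq_one even_iff_mod_2_eq_zero)
  from num_tilings_full_stack[OF assms(2,3) this _ assms(1), of 0] show ?thesis
    by (simp add: AR_carved[OF assms(1)])
qed

text \<open>
  The bottom set has \<open>k\<close> elements, which turns the correction factor into \<open>2 powi (- int k)\<close>.
\<close>

lemma num_tilings_quartered_TR:
  assumes "A \<subseteq> {1..int n}" "card A = k" "m \<le> N" "N \<le> m + 1" "m \<ge> 1" "n \<ge> 1"
    and "\<And>t. Q t \<longleftrightarrow> odd (int N - t)"
  shows "real (num_tilings (TR m n - SW_squares m Q - SE_squares n (\<lambda>j. j \<in> A))) =
    2 powi (- int k) * weight_sum 2 N A"
proof -
  have "(\<lambda>t. of_bool (Q t)) = (\<lambda>t. (int N - t) mod 2)"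
    by (simp add: fun_eq_iff assms(7) odd_iff_mod_2_eq_one even_iff_mod_2_eq_zero)
  from num_tilings_trimmed_stack[OF assms(3,4) this refl assms(6) _ assms(1), of 0]
  have "real (num_tilings (TR m n - SW_squares m Q - SE_squares n (\<lambda>j. j \<in> A))) * 2 ^ k =
      weight_sum 2 N A"
    using assms by (simp add: TR_carved)
  then show ?thesis by (simp add: power_int_minus divide_simps mult.commute)
qed

theorem corollary1p3:
  fixes k n :: nat and a :: "nat \<Rightarrow> int"
  assumes "1 \<le> k" and "k < n"
    and "\<forall>i \<in> {1..k}. 1 \<le> a i \<and> a i \<le> int n"
    and "\<forall>i \<in> {1..k}. \<forall>j \<in> {1..k}. i < j \<longrightarrow> a i < a j"
  shows
    "(num_tilings (RE (2 * k - 1) n a) = num_tilings (RE (2 * k) n a) \<and>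
      real (num_tilings (RE (2 * k) n a)) = q_enumeration 2 (2 * k) a) \<and>
     (num_tilings (RO (2 * k) n a) = num_tilings (RO (2 * k + 1) n a) \<and>
      real (num_tilings (RO (2 * k + 1) n a)) = q_enumeration 2 (2 * k + 1) a) \<and>
     (num_tilings (TE (2 * k) n a) = num_tilings (TE (2 * k + 1) n a) \<and>
      real (num_tilings (TE (2 * k + 1) n a)) =
        2 powi (- int k) * q_enumeration 2 (2 * k + 1) a) \<and>
     (num_tilings (TO (2 * k - 1) n a) = num_tilings (TO (2 * k) n a) \<and>
      real (num_tilings (TO (2 * k) n a)) =
        2 powi (- int k) * q_enumeration 2 (2 * k) a)"
proof -
  let ?A = "a ` {1..k}"
  have A: "?A \<subseteq> {1..int n}" using assms(3) by auto
  have "inj_on a {1..k}"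
    by (rule linorder_inj_onI) (use assms(4) in force)+
  then have card: "card ?A = k" by (simp add: card_image)
  note full = num_tilings_quartered_AR[OF A] and trimmed = num_tilings_quartered_TR[OF A card]
  have q: "q_enumeration 2 (2 * k) a = weight_sum 2 (2 * k) ?A"
    "q_enumeration 2 (2 * k + 1) a = weight_sum 2 (2 * k + 1) ?A"
    by (simp_all add: q_enumeration_eq)
  have RE: "real (num_tilings (RE m n a)) = weight_sum 2 (2 * k) ?A" if "m \<in> {2 * k - 1, 2 * k}" for m
  proof -
    have "(m + 1) div 2 = k" using that assms(1) by auto
    then show ?thesis unfolding RE_def using full[of m "2 * k" even] that assms(1) by auto
  qed
  have RO: "real (num_tilings (RO m n a)) = weight_sum 2 (2 * k + 1) ?A" if "m \<in> {2 * k, 2 * k + 1}" for m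
  proof -
    have "m div 2 = k" using that by auto
    then show ?thesis unfolding RO_def using full[of m "2 * k + 1" odd] that by auto
  qed
  have TE: "real (num_tilings (TE m n a)) = 2 powi (- int k) * weight_sum 2 (2 * k + 1) ?A"
    if "m \<in> {2 * k, 2 * k + 1}" for m
  proof -
    have "m div 2 = k" using that by auto
    then show ?thesis unfolding TE_def using trimmed[of m "2 * k + 1" even] that assms(1,2) by auto
  qed
  have TO: "real (num_tilings (TO m n a)) = 2 powi (- int k) * weight_sum 2 (2 * k) ?A"
    if "m \<in> {2 * k - 1, 2 * k}" for m
  proof -
    have "(m + 1) div 2 = k" using that assms(1) by auto
    then show ?thesis unfolding TO_def using trimmed[of m "2 * k" odd] that assms(1,2) by auto
  qed
  have eqI: "x = y" if "real x = z" "real y = z" for x y z using that by simp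
  show ?thesis
    unfolding q
    by (intro conjI RE RO TE TO eqI[OF RE RE] eqI[OF RO RO] eqI[OF TE TE] eqI[OF TO TO]) simp_all
qed

end
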